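(* There exists a (randomized) algorithm for the graphic matroid secretary problem that is $3.77$-competitive on the family of all finite simple graphs (no parallel edges, no loops) with nonnegative edge weights.
   Context: Graphic matroid secretary problem: the input is a finite undirected multigraph $G=(V,E)$ without loops, with $|V|=n$, $|E|=m$ and edge weights $w:E\to\mathbb{R}_{\ge 0}$. The algorithm knows $V$ and $m$ in advance. The edges arrive one at a time in an order chosen uniformly at random among all orderings of $E$; when an edge arrives the algorithm learns its endpoints and weight and must immediately and irrevocably accept or reject it, subject to the set of accepted edges always being acyclic. The algorithm may use internal randomness. $ALG$ denotes the total weight of accepted edges and $OPT(G)$ the maximum weight of an acyclic edge set of $G$. An algorithm is $\alpha$-competitive on a family of weighted graphs if $\alpha\cdot\mathbb{E}[ALG]\ge OPT(G)$ for every graph in the family (expectation over arrival order and internal randomness). A graph is simple if there is at most one edge between any pair of vertices. *)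

theory Defs
  imports "HOL-Probability.Probability" "HOL-Combinatorics.Multiset_Permutations"
begin

definition simple_graph :: "'v set \<Rightarrow> 'v set set \<Rightarrow> bool" where
  "simple_graph V E \<longleftrightarrow> finite V \<and> (\<forall>e\<in>E. \<exists>u v. u \<in> V \<and> v \<in> V \<and> u \<noteq> v \<and> e = {u, v})"

definition acyclic_edges :: "'v set set \<Rightarrow> bool" where
  "acyclic_edges F \<longleftrightarrow>
     \<not> (\<exists>cs. length cs \<ge> 3 \<and> distinct cs \<and>
            (\<forall>i < length cs. {cs ! i, cs ! ((i + 1) mod length cs)} \<in> F))"

definition OPT :: "'v set set \<Rightarrow> ('v set \<Rightarrow> real) \<Rightarrow> real" where
  "OPT E w = Max ((\<lambda>F. \<Sum>e\<in>F. w e) ` {F. F \<subseteq> E \<and> acyclic_edges F})"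

text \<open>History: for each arrived edge, its endpoints, weight and whether it was accepted.\<close>
type_synonym 'v history = "('v set \<times> real \<times> bool) list"

text \<open>A randomized online algorithm (behavioural form): given the vertex set V, the
  number of edges m, the history so far and the currently arriving edge (endpoints and
  weight), it returns the distribution of its accept/reject decision.\<close>
type_synonym 'v algorithm = "'v set \<Rightarrow> nat \<Rightarrow> 'v history \<Rightarrow> ('v set \<times> real) \<Rightarrow> bool pmf"

definition accepted :: "'v history \<Rightarrow> 'v set set" where
  "accepted h = {e. \<exists>x. (e, x, True) \<in> set h}"

text \<open>Running the algorithm on an arrival order; an accept decision that would
  close a cycle is turned into a rejection (so the accepted set always stays acyclic).\<close>
primrec run :: "'v algorithm \<Rightarrow> 'v set \<Rightarrow> nat \<Rightarrow> ('v set \<Rightarrow> real) \<Rightarrow> 'v set list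
                 \<Rightarrow> 'v history \<Rightarrow> 'v history pmf" where
  "run A V m w [] h = return_pmf h"
| "run A V m w (e # es) h =
     bind_pmf (A V m h (e, w e)) (\<lambda>b.
       run A V m w es (h @ [(e, w e, b \<and> acyclic_edges (insert e (accepted h)))]))"

definition expected_ALG :: "'v algorithm \<Rightarrow> 'v set \<Rightarrow> 'v set set \<Rightarrow> ('v set \<Rightarrow> real) \<Rightarrow> real" where
  "expected_ALG A V E w =
     measure_pmf.expectation
       (bind_pmf (pmf_of_set (permutations_of_set E)) (\<lambda>es. run A V (card E) w es []))
       (\<lambda>h. \<Sum>e\<in>accepted h. w e)"

end

(*  An arriving edge is considered only if it belongs to the maximum weight forest of the edges seen
    so far, and that forest is oriented so that every vertex is the tail of at most one edge.
    After a sampling phase of half of the edges, an edge u -> v is accepted if neither u nor v is the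
    tail of an accepted edge, so no cycle can close.  Given the set S of the first s edges, the last
    one is uniform in S, so the tail of the s-th edge is a given vertex with probability at most
    1/s; asking only that neither u nor v is hit that way gives ratio 4.

    The gain comes from edges that are themselves rejected: a hit v -> x does no harm if x was
    already the tail of an accepted edge.  In a simple graph x differs from u and v, so with P_k
    the probability that k vertices are free, P_2(s) - P_2(s-1) is about -(2/s) P_3, where P_3
    decreases at rate (3/s) P_4 and P_4 decreases at rate at most (4/s) P_4.  With r = N/s this
    gives P_4 >= r^4, P_3 <= 1/4 + 3/4 r^4 and a bound on P_2 whose average over the selection phase
    exceeds 1/3.77.

    The rate of P_3 drops if one of its vertices is a root of the current forest and hence cannot be
    hit.  To compensate, every vertex carries a credit, which shrinks whenever the vertex is a root,
    and u -> v is accepted only with probability equal to the credit of v; the P_k are weighted by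
    credits.  *)

theory Submission
  imports Defs "HOL-Library.Transitive_Closure_Table"
begin

subsection \<open>Acyclic edge sets\<close>

definition conn :: "'v set set \<Rightarrow> ('v \<times> 'v) set" where
  "conn F = {(x, y). {x, y} \<in> F}\<^sup>*"

lemma conn_refl [simp]: "(x, x) \<in> conn F"
  by (simp add: conn_def)

lemma conn_sym: "(x, y) \<in> conn F \<Longrightarrow> (y, x) \<in> conn F"
proof -
  have "sym {(x, y). {x, y} \<in> F}"
    by (auto simp: sym_def insert_commute)
  then show "(x, y) \<in> conn F \<Longrightarrow> (y, x) \<in> conn F"
    unfolding conn_def by (metis sym_rtrancl symD)
qed

lemma conn_trans: "(x, y) \<in> conn F \<Longrightarrow> (y, z) \<in> conn F \<Longrightarrow> (x, z) \<in> conn F"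
  by (simp add: conn_def)

lemma conn_edge: "{x, y} \<in> F \<Longrightarrow> (x, y) \<in> conn F"
  by (auto simp: conn_def)

lemma conn_mono: "F \<subseteq> G \<Longrightarrow> (x, y) \<in> conn F \<Longrightarrow> (x, y) \<in> conn G"
  unfolding conn_def by (erule rtrancl_mono[THEN subsetD, rotated]) auto

lemma conn_insert: "(x, y) \<in> conn F \<Longrightarrow> (x, y) \<in> conn (insert e F)"
  by (rule conn_mono) auto

lemma conn_edges_subset:
  assumes "\<And>x y. {x, y} \<in> F \<Longrightarrow> (x, y) \<in> conn G" and "(a, b) \<in> conn F"
  shows "(a, b) \<in> conn G"
  using assms(2) unfolding conn_def[of F]
  by (induction rule: rtrancl_induct) (use assms(1) in \<open>auto intro: conn_trans\<close>)

lemma acyclic_edges_mono: "acyclic_edges G \<Longrightarrow> F \<subseteq> G \<Longrightarrow> acyclic_edges F"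
  unfolding acyclic_edges_def by blast

lemma acyclic_edges_empty [simp]: "acyclic_edges {}"
  unfolding acyclic_edges_def by fastforce

text \<open>With two vertices the way forth and the way back would be the same edge. From three on,
  equal edges at \<open>i\<close> and \<open>j\<close> would make each index the cyclic successor of
  the other.\<close>

lemma cycle_edges_inj:
  assumes n: "length cs \<ge> 3" and d: "distinct cs" and i: "i < length cs" and j: "j < length cs"
    and eq: "{cs ! i, cs ! ((i + 1) mod length cs)} = {cs ! j, cs ! ((j + 1) mod length cs)}"
  shows "i = j"
proof (rule ccontr)
  assume "i \<noteq> j"
  let ?n = "length cs"
  have m: "(i + 1) mod ?n < ?n" "(j + 1) mod ?n < ?n" using n by (auto intro!: mod_less_divisor)
  have "cs ! i \<noteq> cs ! j" using \<open>i \<noteq> j\<close> d i j by (simp add: nth_eq_iff_index_eq)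
  then have "cs ! i = cs ! ((j + 1) mod ?n)" "cs ! ((i + 1) mod ?n) = cs ! j"
    using eq by (auto simp: doubleton_eq_iff)
  then have ij: "i = (j + 1) mod ?n" "j = (i + 1) mod ?n"
    using d i j m by (auto simp: nth_eq_iff_index_eq)
  have md: "(k + 1) mod ?n = 0 \<and> k + 1 = ?n \<or> (k + 1) mod ?n = k + 1" if "k < ?n" for k
    using that by (cases "k + 1 = ?n") auto
  show False
    using md[OF i, folded ij(2)] md[OF j, folded ij(1)] n \<open>i \<noteq> j\<close> by linarith
qed

text \<open>A new cycle has to use \<open>{a, b}\<close> and uses it only once, so the rest of the
  cycle is a walk in \<open>F\<close> between the two ends of that edge.\<close>

lemma acyclic_edges_insert:
  assumes F: "acyclic_edges F" and ab: "(a, b) \<notin> conn F"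
  shows "acyclic_edges (insert {a, b} F)"
  unfolding acyclic_edges_def
proof
  assume "\<exists>cs. length cs \<ge> 3 \<and> distinct cs \<and>
      (\<forall>i < length cs. {cs ! i, cs ! ((i + 1) mod length cs)} \<in> insert {a, b} F)"
  then obtain cs where cs: "length cs \<ge> 3" "distinct cs"
    and e: "\<And>i. i < length cs \<Longrightarrow> {cs ! i, cs ! ((i + 1) mod length cs)} \<in> insert {a, b} F"
    by blast
  let ?n = "length cs" and ?e = "\<lambda>i. {cs ! i, cs ! ((i + 1) mod length cs)}"
  obtain i where i: "i < ?n" "?e i \<notin> F" using F cs unfolding acyclic_edges_def by blast
  then have ei: "?e i = {a, b}" using e by blast
  have other: "?e k \<in> F" if "k < ?n" "k \<noteq> i" for k
    using e[OF that(1)] cycle_edges_inj[OF cs that(1) i(1)] ei that by auto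
  \<comment> \<open>The walk starts behind the new edge at position \<open>i\<close>; for
    \<open>k = ?n - 1\<close> it has gone all the way round and ends at
    \<open>cs ! i\<close>.\<close>
  have walk: "(cs ! ((i + 1) mod ?n), cs ! ((i + 1 + k) mod ?n)) \<in> conn F" if "k < ?n" for k
    using that
  proof (induction k)
    case (Suc k)
    let ?j = "(i + 1 + k) mod ?n"
    have j: "?j < ?n" using cs by (auto intro!: mod_less_divisor)
    have "?j \<noteq> i"
    proof
      assume "?j = i"
      moreover have "?j = (if i + 1 + k < ?n then i + 1 + k else i + 1 + k - ?n)"
        using i Suc.prems by (auto simp: le_mod_geq not_less)
      ultimately show False using Suc.prems i by (auto split: if_splits)
    qed
    from other[OF j this] have "{cs ! ?j, cs ! ((?j + 1) mod ?n)} \<in> F" .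
    moreover have "(?j + 1) mod ?n = (i + 1 + Suc k) mod ?n" by (simp add: mod_simps)
    ultimately have "(cs ! ?j, cs ! ((i + 1 + Suc k) mod ?n)) \<in> conn F"
      by (simp add: conn_edge)
    with Suc.IH Suc.prems show ?case by (simp add: conn_trans[of _ "cs ! ?j"])
  qed simp
  have "i + 1 + (?n - 1) = i + ?n" using i by simp
  then have "(i + 1 + (?n - 1)) mod ?n = i" using i by simp
  then have "(cs ! ((i + 1) mod ?n), cs ! i) \<in> conn F"
    using walk[of "?n - 1"] i by simp
  moreover have "cs ! i = a \<and> cs ! ((i + 1) mod ?n) = b \<or> cs ! i = b \<and> cs ! ((i + 1) mod ?n) = a"
    using ei by (simp only: doubleton_eq_iff)
  ultimately show False using ab conn_sym by metis
qed

text \<open>A path with distinct vertices from \<open>a\<close> to \<open>b\<close> would be closed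
  to a cycle by \<open>{a, b}\<close>. It has at least three vertices because \<open>{a, b}\<close>
  itself is not in \<open>F\<close>.\<close>

lemma acyclic_edges_insertD:
  assumes ac: "acyclic_edges (insert {a, b} F)" and nin: "{a, b} \<notin> F" and "a \<noteq> b"
  shows "(a, b) \<notin> conn F"
proof
  assume "(a, b) \<in> conn F"
  then have "(\<lambda>x y. {x, y} \<in> F)\<^sup>*\<^sup>* a b" by (simp add: conn_def rtranclp_rtrancl_eq)
  then obtain ys where "rtrancl_path (\<lambda>x y. {x, y} \<in> F) a ys b"
    by (auto simp: rtranclp_eq_rtrancl_path)
  then obtain xs where p: "rtrancl_path (\<lambda>x y. {x, y} \<in> F) a xs b" and d: "distinct (a # xs)"
    by (rule rtrancl_path_distinct)
  have ne: "xs \<noteq> []" using p \<open>a \<noteq> b\<close> by (auto elim: rtrancl_path.cases)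
  then have last: "last xs = b" using rtrancl_path_last[OF p] by simp
  have nth: "{(a # xs) ! i, xs ! i} \<in> F" if "i < length xs" for i
    using rtrancl_path_nth[OF p that] .
  have "length xs \<noteq> 1"
  proof
    assume "length xs = 1"
    then have "xs = [b]" using last by (cases xs) auto
    then show False using nth[of 0] nin by simp
  qed
  then have l3: "length (a # xs) \<ge> 3" using ne by (cases xs) (auto simp: Suc_le_eq)
  have "{(a # xs) ! i, (a # xs) ! ((i + 1) mod length (a # xs))} \<in> insert {a, b} F"
    if "i < length (a # xs)" for i
  proof (cases "i < length xs")
    case True
    then show ?thesis using nth[OF True] by simp
  next
    case False
    then have "i = length xs" using that by simp
    then show ?thesis using last ne by (simp add: last_conv_nth nth_Cons' insert_commute)
  qed
  then show False using ac l3 d unfolding acyclic_edges_def by blast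
qed

text \<open>A cycle has as many edges as vertices, so the injective map of its edges to vertices would
  hit \<open>v\<close>.\<close>
lemma acyclic_edges_insert_tail:
  assumes F: "acyclic_edges F" and inj: "inj_on t F" and t: "\<And>e. e \<in> F \<Longrightarrow> t e \<in> e"
    and u: "u \<notin> t ` F" and v: "v \<notin> t ` F" and uv: "u \<noteq> v"
  shows "acyclic_edges (insert {u, v} F)"
  unfolding acyclic_edges_def
proof
  assume "\<exists>cs. length cs \<ge> 3 \<and> distinct cs \<and>
      (\<forall>i < length cs. {cs ! i, cs ! ((i + 1) mod length cs)} \<in> insert {u, v} F)"
  then obtain cs where cs: "length cs \<ge> 3" "distinct cs"
    and e: "\<And>i. i < length cs \<Longrightarrow> {cs ! i, cs ! ((i + 1) mod length cs)} \<in> insert {u, v} F"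
    by blast
  let ?n = "length cs"
  define ed where "ed i = {cs ! i, cs ! ((i + 1) mod length cs)}" for i
  define s where "s = t({u, v} := u)"
  have nF: "{u, v} \<notin> F"
  proof
    assume "{u, v} \<in> F"
    then show False using t[of "{u, v}"] u v by (metis image_eqI insert_iff singletonD)
  qed
  have m: "(i + 1) mod ?n < ?n" for i using cs by (auto intro!: mod_less_divisor)
  have injs: "inj_on s (insert {u, v} F)"
    using inj nF u unfolding s_def inj_on_def by auto
  have inje: "inj_on ed {..<?n}"
    unfolding ed_def inj_on_def using cycle_edges_inj[OF cs] by blast
  have ein: "ed ` {..<?n} \<subseteq> insert {u, v} F" using e by (auto simp: ed_def)
  have sin: "s (ed i) \<in> set cs" if "i < ?n" for i
  proof -
    have "s (ed i) \<in> ed i" using e[OF that] t unfolding s_def ed_def by auto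
    then show ?thesis using that m[of i] unfolding ed_def by auto
  qed
  have "inj_on (s \<circ> ed) {..<?n}"
    by (rule comp_inj_on[OF inje]) (rule inj_on_subset[OF injs ein])
  then have "card ((s \<circ> ed) ` {..<?n}) = card (set cs)"
    using cs card_image[of "s \<circ> ed" "{..<?n}"] by (simp add: distinct_card)
  then have surj: "(s \<circ> ed) ` {..<?n} = set cs"
    using sin by (intro card_subset_eq) auto
  obtain i where i: "i < ?n" "ed i \<notin> F" using F cs unfolding acyclic_edges_def ed_def by blast
  then have "ed i = {u, v}" using e unfolding ed_def by blast
  moreover have "ed i \<subseteq> set cs" using i m[of i] unfolding ed_def by auto
  ultimately have "v \<in> set cs" by auto
  then obtain j where j: "j < ?n" "v = s (ed j)" using surj by force
  then have "ed j \<in> insert {u, v} F" using ein by blast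
  then show False using j uv v unfolding s_def by (cases "ed j = {u, v}") auto
qed

text \<open>Directing every tree towards a root gives such a \<open>t\<close>. The set
  \<open>R\<close> of forbidden tails, at most one per component, serves the induction: a removed
  edge \<open>g\<close> gets a tail \<open>c\<close>, and \<open>c\<close> is then forbidden for the
  remaining edges.\<close>

lemma acyclic_edges_orientation:
  assumes "finite F" "acyclic_edges F" "\<And>e. e \<in> F \<Longrightarrow> \<exists>a b. a \<noteq> b \<and> e = {a, b}"
    and "\<And>x y. x \<in> R \<Longrightarrow> y \<in> R \<Longrightarrow> x \<noteq> y \<Longrightarrow> (x, y) \<notin> conn F"
  shows "\<exists>t. inj_on t F \<and> (\<forall>e\<in>F. t e \<in> e) \<and> t ` F \<inter> R = {}"
  using assms
proof (induction F arbitrary: R rule: finite_induct)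
  case empty
  then show ?case by auto
next
  case (insert g F)
  obtain a b where ab: "a \<noteq> b" "g = {a, b}" using insert.prems(2) by blast
  have nab: "(a, b) \<notin> conn F"
    using acyclic_edges_insertD insert ab by metis
  have F: "acyclic_edges F" using insert.prems(1) acyclic_edges_mono by blast
  have R: "(x, y) \<notin> conn F" if "x \<in> R" "y \<in> R" "x \<noteq> y" for x y
    using insert.prems(3)[OF that] conn_insert by metis
  have gc: "(a, b) \<in> conn (insert g F)" using ab by (auto intro: conn_edge)
  have step: ?case if c: "c \<in> g" "c \<notin> R" "\<And>x. x \<in> R \<Longrightarrow> (x, c) \<notin> conn F" for c
  proof -
    have "\<exists>t. inj_on t F \<and> (\<forall>e\<in>F. t e \<in> e) \<and> t ` F \<inter> insert c R = {}"
      using F insert.prems(2) R c by (intro insert.IH) (auto dest: conn_sym)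
    then obtain t where t: "inj_on t F" "\<forall>e\<in>F. t e \<in> e" "t ` F \<inter> insert c R = {}" by blast
    have eq: "(t(g := c)) ` F = t ` F" using insert.hyps by (auto simp: image_def)
    have "inj_on (t(g := c)) (insert g F)"
      using t insert.hyps unfolding inj_on_def by auto
    moreover have "\<forall>e\<in>insert g F. (t(g := c)) e \<in> e" using t c by auto
    moreover have "(t(g := c)) ` insert g F \<inter> R = {}" using t c eq by auto
    ultimately show ?thesis by blast
  qed
  \<comment> \<open>The tail must be an end of \<open>g\<close> that \<open>F\<close> does not
    connect to \<open>R\<close>. If both ends were connected to \<open>R\<close>, then
    \<open>g\<close> would join two members of \<open>R\<close> or close a cycle.\<close>
  show ?case
  proof (cases "\<exists>r\<in>R. (r, a) \<in> conn F")
    case True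
    then obtain r where r: "r \<in> R" "(r, a) \<in> conn F" by blast
    have ra: "(r, a) \<in> conn (insert g F)" using r by (simp add: conn_insert)
    have nb: "(x, b) \<notin> conn F" if x: "x \<in> R" for x
    proof
      assume xb: "(x, b) \<in> conn F"
      then have "x \<noteq> r" using conn_trans[OF conn_sym[OF r(2)]] nab by blast
      moreover have "(x, r) \<in> conn (insert g F)"
        using conn_trans[OF conn_trans[OF conn_insert[OF xb] conn_sym[OF gc]] conn_sym[OF ra]] .
      ultimately show False using insert.prems(3) x r by blast
    qed
    then have "b \<notin> R" using conn_refl[of b F] by metis
    then show ?thesis using step[of b] nb ab by simp
  next
    case False
    then have "a \<notin> R" using conn_refl[of a F] by metis
    then show ?thesis using step[of a] False ab by simp
  qed
qed

subsection \<open>Maximum weight forests and their orientation\<close>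

definition better :: "('e \<Rightarrow> real) \<Rightarrow> ('e \<Rightarrow> nat) \<Rightarrow> 'e \<Rightarrow> 'e \<Rightarrow> bool" where
  "better w g f e \<longleftrightarrow> w e < w f \<or> w e = w f \<and> g e < g f"

text \<open>Kruskal's forest with ties broken by \<open>g\<close>, described edge by edge: an edge
  is dropped when better edges already connect its ends. The forest thus depends on the set
  \<open>S\<close> alone, and an edge of it stays in the forest of every smaller set that contains
  it.\<close>

definition forest :: "('v set \<Rightarrow> real) \<Rightarrow> ('v set \<Rightarrow> nat) \<Rightarrow> 'v set set \<Rightarrow> 'v set set" where
  "forest w g S = {e \<in> S. \<forall>a b. e = {a, b} \<longrightarrow> (a, b) \<notin> conn {f \<in> S. better w g f e}}"

lemma forest_subset: "forest w g S \<subseteq> S"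
  by (auto simp: forest_def)

lemma forest_mono:
  assumes "e \<in> forest w g S" "S' \<subseteq> S" "e \<in> S'"
  shows "e \<in> forest w g S'"
proof -
  define B where "B T = {f \<in> T. better w g f e}" for T
  have all: "\<forall>a b. e = {a, b} \<longrightarrow> (a, b) \<notin> conn (B S)"
    using assms(1) unfolding forest_def mem_Collect_eq B_def by (rule conjunct2)
  have sub: "B S' \<subseteq> B S" using assms(2) by (auto simp: B_def)
  have "\<forall>a b. e = {a, b} \<longrightarrow> (a, b) \<notin> conn (B S')"
  proof (intro allI impI notI)
    fix a b assume "e = {a, b}" "(a, b) \<in> conn (B S')"
    then show False using all[rule_format, of a b] conn_mono[OF sub, of a b] by simp
  qed
  with assms(3) show ?thesis
    unfolding forest_def mem_Collect_eq B_def by (rule conjI)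
qed

lemma forest_cong:
  assumes "\<And>e. e \<in> S \<Longrightarrow> w e = w' e"
  shows "forest w g S = forest w' g S"
proof -
  have *: "{f \<in> S. better w g f e} = {f \<in> S. better w' g f e}" if "e \<in> S" for e
    using assms that by (auto simp: better_def)
  have "e \<in> forest w g S \<longleftrightarrow> e \<in> forest w' g S" if "e \<in> S" for e
    by (simp only: forest_def mem_Collect_eq *[OF that])
  then show ?thesis using forest_subset[of w g S] forest_subset[of w' g S] by blast
qed

text \<open>Kruskal's order: edges are added from the best to the worst, so the edge added last is
  worse than all others.\<close>

lemma worst_edge_induct [consumes 2, case_names empty insert]:
  assumes "finite S" "inj_on g S" and e: "P {}"
    and i: "\<And>h T. insert h T \<subseteq> S \<Longrightarrow> h \<notin> T \<Longrightarrow> (\<And>f. f \<in> T \<Longrightarrow> better w g f h) \<Longrightarrow> P T \<Longrightarrow> P (insert h T)"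
  shows "P S"
proof -
  have "P T" if "T \<subseteq> S" for T
    using finite_subset[OF that \<open>finite S\<close>] that
  proof (induction T rule: finite_psubset_induct)
    case (psubset T)
    show ?case
    proof (cases "T = {}")
      case False
      define M where "M = Min (w ` T)"
      define T0 where "T0 = {f \<in> T. w f = M}"
      have "M \<in> w ` T" unfolding M_def using psubset.hyps False by (intro Min_in) auto
      then have "T0 \<noteq> {}" "finite T0" using psubset.hyps by (auto simp: T0_def)
      then have "Min (g ` T0) \<in> g ` T0" by (intro Min_in) auto
      then obtain h where h: "h \<in> T0" "g h = Min (g ` T0)" by auto
      have wM: "M \<le> w f" if "f \<in> T" for f using that psubset.hyps by (simp add: M_def)
      have gM: "g h \<le> g f" if "f \<in> T0" for f using that h \<open>finite T0\<close> by simp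
      have hT: "h \<in> T" "w h = M" using h by (auto simp: T0_def)
      have "better w g f h" if f: "f \<in> T - {h}" for f
      proof (cases "w f = M")
        case True
        then have "f \<in> T0" using f by (simp add: T0_def)
        moreover have "g f \<noteq> g h"
          using \<open>inj_on g S\<close> f hT psubset.prems unfolding inj_on_def by blast
        ultimately show ?thesis using gM[of f] True hT by (simp add: better_def)
      next
        case False
        then show ?thesis using wM[of f] f hT by (simp add: better_def)
      qed
      moreover have "P (T - {h})" using hT psubset.prems by (intro psubset.IH) auto
      ultimately have "P (insert h (T - {h}))"
        using hT psubset.prems by (intro i) auto
      then show ?thesis using hT by (simp add: insert_absorb)
    qed (use e in simp)
  qed
  then show ?thesis by blast
qed

text \<open>The worst edge is better than no other edge, so it does not influence whether the others
  belong to the forest.\<close>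

lemma forest_insert_worst:
  assumes h: "{a, b} \<notin> T" and worst: "\<And>f. f \<in> T \<Longrightarrow> better w g f {a, b}"
  shows "forest w g (insert {a, b} T) =
    (if (a, b) \<in> conn T then forest w g T else insert {a, b} (forest w g T))"
proof -
  have *: "{f \<in> insert {a, b} T. better w g f e} = {f \<in> T. better w g f e}" if "e \<in> T" for e
    using worst[OF that] by (auto simp: better_def)
  have 1: "e \<in> forest w g (insert {a, b} T) \<longleftrightarrow> e \<in> forest w g T" if "e \<in> T" for e
    unfolding forest_def mem_Collect_eq *[OF that] using that by simp
  have **: "{f \<in> insert {a, b} T. better w g f {a, b}} = T"
    using worst h by (auto simp: better_def)
  have 2: "{a, b} \<in> forest w g (insert {a, b} T) \<longleftrightarrow> (a, b) \<notin> conn T"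
    unfolding forest_def mem_Collect_eq ** doubleton_eq_iff using conn_sym[of b a T] by blast
  show ?thesis
    using 1 2 h forest_subset[of w g T] forest_subset[of w g "insert {a, b} T"] by auto
qed

lemma acyclic_forest:
  assumes "finite S" "inj_on g S" and S: "\<And>e. e \<in> S \<Longrightarrow> \<exists>a b. a \<noteq> b \<and> e = {a, b}"
  shows "acyclic_edges (forest w g S)"
  using assms(1,2)
proof (induction rule: worst_edge_induct[where w = w])
  case empty
  then show ?case by (simp add: forest_def)
next
  case (insert h T)
  obtain a b where h: "h = {a, b}" using S insert.hyps(1) by blast
  show ?case
  proof (cases "(a, b) \<in> conn T")
    case True
    then show ?thesis using insert forest_insert_worst[of a b T w g] by (simp add: h)
  next
    case False
    then have "(a, b) \<notin> conn (forest w g T)" using conn_mono[OF forest_subset] by metis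
    then show ?thesis
      using insert False forest_insert_worst[of a b T w g]
      by (simp add: h acyclic_edges_insert)
  qed
qed

text \<open>When the worst edge is redundant, it can be exchanged in a competing forest for an edge that
  is at least as heavy.\<close>
lemma sum_le_forest:
  assumes "finite S" "inj_on g S" and S: "\<And>e. e \<in> S \<Longrightarrow> \<exists>a b. a \<noteq> b \<and> e = {a, b}"
    and w: "\<And>e. e \<in> S \<Longrightarrow> 0 \<le> w e" and "F \<subseteq> S" "acyclic_edges F"
  shows "sum w F \<le> sum w (forest w g S)"
  using assms(1,2,5,6)
proof (induction arbitrary: F rule: worst_edge_induct[where w = w])
  case empty
  then show ?case by (simp add: forest_def)
next
  case (insert h T)
  obtain a b where h: "h = {a, b}" "a \<noteq> b" using S insert.hyps(1) by blast
  have fT: "finite T" using insert.hyps(1) \<open>finite S\<close> finite_subset by auto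
  have fin: "finite (forest w g T)" using fT forest_subset finite_subset by metis
  have hT: "h \<notin> forest w g T" using insert.hyps(2) forest_subset by blast
  have wh: "0 \<le> w h" using w insert.hyps(1) by blast
  have F: "forest w g (insert h T) = (if (a, b) \<in> conn T then forest w g T else insert h (forest w g T))"
    using forest_insert_worst[of a b T w g] insert.hyps by (simp add: h)
  then have grow: "sum w (forest w g T) \<le> sum w (forest w g (insert h T))"
    using hT fin wh by simp
  show ?case
  proof (cases "h \<in> F")
    case False
    then have "sum w F \<le> sum w (forest w g T)" using insert by blast
    then show ?thesis using grow by simp
  next
    case True
    define F' where "F' = F - {h}"
    have F': "F' \<subseteq> T" "acyclic_edges F'" "insert h F' = F" "h \<notin> F'"
      using True insert.prems acyclic_edges_mono[of F F'] by (auto simp: F'_def)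
    have "finite F'" using F'(1) fT finite_subset by auto
    have sF: "sum w F = w h + sum w F'" using F' \<open>finite F'\<close> by auto
    show ?thesis
    proof (cases "(a, b) \<in> conn T")
      case False
      then have "sum w (forest w g (insert h T)) = w h + sum w (forest w g T)"
        using F hT fin by simp
      then show ?thesis using insert.IH[OF F'(1,2)] sF by simp
    next
      case True
      \<comment> \<open>As \<open>F'\<close> together with \<open>h\<close> is acyclic,
        \<open>F'\<close> separates \<open>a\<close> from \<open>b\<close>, whereas \<open>T\<close>
        connects them. Hence some edge \<open>{x, y}\<close> of \<open>T\<close> joins two
        components of \<open>F'\<close> and can replace \<open>h\<close>.\<close>
      have "(a, b) \<notin> conn F'"
        using insert.prems(2) F'(3,4) h by (intro acyclic_edges_insertD) auto
      then obtain x y where xy: "{x, y} \<in> T" "(x, y) \<notin> conn F'"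
        using conn_edges_subset[OF _ True] by metis
      have "{x, y} \<notin> F'" using xy conn_edge by metis
      moreover have "acyclic_edges (insert {x, y} F')"
        using F'(2) xy(2) by (rule acyclic_edges_insert)
      then have "sum w (insert {x, y} F') \<le> sum w (forest w g T)"
        using insert.IH F'(1) xy(1) by simp
      moreover have "w h \<le> w {x, y}" using insert.hyps(3)[OF xy(1)] by (auto simp: better_def)
      ultimately show ?thesis using sF grow \<open>finite F'\<close> by simp
    qed
  qed
qed

lemma OPT_le_forest:
  assumes "finite S" "inj_on g S" "\<And>e. e \<in> S \<Longrightarrow> \<exists>a b. a \<noteq> b \<and> e = {a, b}"
    and "\<And>e. e \<in> S \<Longrightarrow> 0 \<le> w e"
  shows "OPT S w \<le> sum w (forest w g S)"
proof -
  have "{F. F \<subseteq> S \<and> acyclic_edges F} \<noteq> {}" using acyclic_edges_empty by blast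
  moreover have "finite {F. F \<subseteq> S \<and> acyclic_edges F}" using \<open>finite S\<close> by simp
  ultimately show ?thesis
    unfolding OPT_def using sum_le_forest[OF assms] by (subst Max_le_iff) auto
qed

text \<open>The choice depends on the forest only, hence on the set of seen edges and not on their
  order. So once that set is fixed, the last arrival is uniform in a set with a fixed
  orientation.\<close>

definition tail :: "'v set set \<Rightarrow> 'v set \<Rightarrow> 'v" where
  "tail F = (SOME t. inj_on t F \<and> (\<forall>e\<in>F. t e \<in> e))"

definition head :: "'v set set \<Rightarrow> 'v set \<Rightarrow> 'v" where
  "head F e = the_elem (e - {tail F e})"

lemma tail_forest:
  assumes "finite S" "inj_on g S" "\<And>e. e \<in> S \<Longrightarrow> \<exists>a b. a \<noteq> b \<and> e = {a, b}"
  shows "inj_on (tail (forest w g S)) (forest w g S)"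
    and "\<And>e. e \<in> forest w g S \<Longrightarrow> tail (forest w g S) e \<in> e"
proof -
  let ?F = "forest w g S"
  have "\<exists>t. inj_on t ?F \<and> (\<forall>e\<in>?F. t e \<in> e) \<and> t ` ?F \<inter> {} = {}"
    using acyclic_forest[OF assms] finite_subset[OF forest_subset assms(1)]
      assms(3) forest_subset[of w g S]
    by (intro acyclic_edges_orientation) auto
  then have "\<exists>t. inj_on t ?F \<and> (\<forall>e\<in>?F. t e \<in> e)" by blast
  then have *: "inj_on (tail ?F) ?F \<and> (\<forall>e\<in>?F. tail ?F e \<in> e)"
    unfolding tail_def by (rule someI_ex)
  then show "inj_on (tail ?F) ?F" "\<And>e. e \<in> ?F \<Longrightarrow> tail ?F e \<in> e" by auto
qed

lemma head_edge:
  assumes "a \<noteq> b" "tail F {a, b} \<in> {a, b}"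
  shows "{tail F {a, b}, head F {a, b}} = {a, b}" "head F {a, b} \<noteq> tail F {a, b}"
proof -
  have "tail F {a, b} = a \<and> head F {a, b} = b \<or> tail F {a, b} = b \<and> head F {a, b} = a"
  proof (cases "tail F {a, b} = a")
    case True
    then have "{a, b} - {tail F {a, b}} = {b}" using assms(1) by auto
    then show ?thesis using True by (simp add: head_def)
  next
    case False
    then have "tail F {a, b} = b" using assms(2) by simp
    moreover from this have "{a, b} - {tail F {a, b}} = {a}" using assms(1) by auto
    ultimately show ?thesis by (simp add: head_def)
  qed
  then show "{tail F {a, b}, head F {a, b}} = {a, b}" "head F {a, b} \<noteq> tail F {a, b}"
    using assms(1) by (auto simp: insert_commute)
qed

subsection \<open>The algorithm\<close>

text \<open>Ties must be broken independently of the arrival order. As \<open>V\<close> is known in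
  advance, all its subsets can be numbered beforehand.\<close>

definition rk :: "'v set \<Rightarrow> 'v set \<Rightarrow> nat" where
  "rk V = (SOME g. inj_on g (Pow V))"

lemma inj_on_rk:
  assumes "finite V" shows "inj_on (rk V) (Pow V)"
proof -
  have "\<exists>f :: 'a set \<Rightarrow> nat. inj_on f (Pow V)"
    using finite_imp_inj_to_nat_seg[of "Pow V"] assms by (simp only: finite_Pow_iff) metis
  then show ?thesis unfolding rk_def by (rule someI_ex)
qed

text \<open>Weights are looked up in the history, since no others are known. By
  \<open>forest_cong\<close> only the weights of seen edges matter, and for these the lookup
  succeeds.\<close>

definition seen_forest :: "'v set \<Rightarrow> 'v history \<Rightarrow> 'v set set" where
  "seen_forest V r =
     forest (\<lambda>e. the (map_of (map (\<lambda>(e, x, b). (e, x)) r) e)) (rk V) (fst ` set r)"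

text \<open>Histories are read backwards in \<open>busy\<close> and \<open>cred\<close>: the latest arrival is the head of the
  list.\<close>
primrec busy :: "'v set \<Rightarrow> 'v history \<Rightarrow> 'v set" where
  "busy V [] = {}"
| "busy V (a # r) =
     (if snd (snd a) then insert (tail (seen_forest V (a # r)) (fst a)) (busy V r) else busy V r)"

primrec cred :: "nat \<Rightarrow> (nat \<Rightarrow> real) \<Rightarrow> 'v set \<Rightarrow> 'v history \<Rightarrow> 'v \<Rightarrow> real" where
  "cred N \<theta> V [] x = 1"
| "cred N \<theta> V (a # r) x = cred N \<theta> V r x *
     (if length r < N \<or> x \<in> tail (seen_forest V (a # r)) ` seen_forest V (a # r)
      then 1 else \<theta> (Suc (length r)))"

text \<open>The flag \<open>False\<close> of the arriving edge is a placeholder that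
  \<open>seen_forest\<close> ignores. Accepting with the credit of the head as probability makes the
  loss in \<open>Ex_val_snoc\<close> exactly a value of \<open>val\<close> with one more
  vertex.\<close>

definition alg :: "nat \<Rightarrow> (nat \<Rightarrow> real) \<Rightarrow> 'v set \<Rightarrow> 'v history \<Rightarrow> 'v set \<times> real \<Rightarrow> bool pmf" where
  "alg N \<theta> V h a = (let r = rev h; e = fst a; F = seen_forest V ((e, snd a, False) # r) in
     if N \<le> length r \<and> e \<in> F \<and> tail F e \<notin> busy V r \<and> head F e \<notin> busy V r
     then bernoulli_pmf (cred N \<theta> V r (head F e)) else return_pmf False)"

lemma seen_forest_eq:
  assumes "\<forall>(e, x, b) \<in> set r. x = w e"
  shows "seen_forest V r = forest w (rk V) (fst ` set r)"
  unfolding seen_forest_def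
proof (rule forest_cong)
  fix e assume "e \<in> fst ` set r"
  then have "e \<in> fst ` set (map (\<lambda>(e, x, b). (e, x)) r)" by force
  then obtain x where x: "map_of (map (\<lambda>(e, x, b). (e, x)) r) e = Some x"
    by (metis map_of_eq_None_iff not_Some_eq)
  from map_of_SomeD[OF x] have "x = w e" using assms by auto
  with x show "the (map_of (map (\<lambda>(e, x, b). (e, x)) r) e) = w e" by simp
qed

lemma accepted_snoc: "accepted (h @ [(e, x, b)]) = (if b then insert e (accepted h) else accepted h)"
  by (auto simp: accepted_def)

lemma accepted_subset: "accepted h \<subseteq> fst ` set h"
  by (force simp: accepted_def)

text \<open>\<open>run\<close> recurses on the first arrival, whereas the analysis conditions on the
  last one, which is uniform in the set of seen edges.\<close>

lemma run_snoc:
  "run A V m w (es @ [e]) h = bind_pmf (run A V m w es h) (\<lambda>h'. bind_pmf (A V m h' (e, w e))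
     (\<lambda>b. return_pmf (h' @ [(e, w e, b \<and> acyclic_edges (insert e (accepted h')))])))"
  by (induction es arbitrary: h) (simp_all add: bind_return_pmf bind_assoc_pmf)

lemma permutations_of_set_snoc:
  assumes "S \<noteq> {}"
  shows "permutations_of_set S = (\<Union>e\<in>S. (\<lambda>l. l @ [e]) ` permutations_of_set (S - {e}))"
proof (intro equalityI subsetI)
  fix l assume l: "l \<in> permutations_of_set S"
  then have "l \<noteq> []" using assms by (auto simp: permutations_of_set_def)
  then obtain k e where k: "l = k @ [e]" by (cases l rule: rev_cases) auto
  then have "e \<in> S" "k \<in> permutations_of_set (S - {e})"
    using l by (auto simp: permutations_of_set_def)
  then show "l \<in> (\<Union>e\<in>S. (\<lambda>l. l @ [e]) ` permutations_of_set (S - {e}))"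
    unfolding k by (intro UN_I[of e] imageI)
next
  fix l assume "l \<in> (\<Union>e\<in>S. (\<lambda>l. l @ [e]) ` permutations_of_set (S - {e}))"
  then obtain e k where e: "e \<in> S" "k \<in> permutations_of_set (S - {e})" "l = k @ [e]"
    by (elim UN_E imageE)
  have "set l = S" "distinct l"
    unfolding e(3) using e(1) permutations_of_setD[OF e(2)] by (simp_all add: insert_absorb)
  then show "l \<in> permutations_of_set S" by (rule permutations_of_setI)
qed

lemma sum_permutations_snoc:
  assumes "finite S" "S \<noteq> {}"
  shows "(\<Sum>l\<in>permutations_of_set S. f l) =
    (\<Sum>e\<in>S. \<Sum>l\<in>permutations_of_set (S - {e}). f (l @ [e]))"
  using assms
  by (subst permutations_of_set_snoc, simp, subst sum.UNION_disjoint)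
    (auto simp: sum.reindex inj_on_def)

lemma prod_list_if_power:
  "prod_list (map (\<lambda>x. if P x then 1 else (t :: real)) W) = t ^ length (filter (\<lambda>x. \<not> P x) W)"
  by (induction W) auto

section \<open>The process on a fixed graph along a fixed arrival order\<close>

locale online_forest =
  fixes V :: "'v set" and E :: "'v set set" and w :: "'v set \<Rightarrow> real" and m N :: nat
    and \<theta> :: "nat \<Rightarrow> real" and A :: "'v algorithm"
  assumes graph: "simple_graph V E"
    and A: "A V m = alg N \<theta> V"
    and \<theta>: "0 \<le> \<theta> s" "\<theta> s \<le> 1"
begin

abbreviation T :: "'v set set \<Rightarrow> 'v set set" where
  "T \<equiv> forest w (rk V)"

lemma edge_doubleton_V:
  assumes "e \<in> E" shows "\<exists>a b. a \<in> V \<and> b \<in> V \<and> a \<noteq> b \<and> e = {a, b}"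
  using graph[unfolded simple_graph_def, THEN conjunct2, rule_format, OF assms] .

lemma edges_subset_Pow: "E \<subseteq> Pow V"
proof
  fix e assume "e \<in> E"
  from edge_doubleton_V[OF this] obtain u v where "u \<in> V \<and> v \<in> V \<and> u \<noteq> v \<and> e = {u, v}"
    by (elim exE)
  then show "e \<in> Pow V" by simp
qed

lemma finite_V: "finite V"
  using graph by (simp add: simple_graph_def)

lemma finite_edges: "S \<subseteq> E \<Longrightarrow> finite S"
  using edges_subset_Pow finite_V by (meson finite_Pow_iff finite_subset)

lemma inj_on_rk_edges: "S \<subseteq> E \<Longrightarrow> inj_on (rk V) S"
  using edges_subset_Pow by (intro inj_on_subset[OF inj_on_rk[OF finite_V]]) auto

lemma edge_doubleton:
  assumes "e \<in> E" shows "\<exists>a b. a \<noteq> b \<and> e = {a, b}"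
  using edge_doubleton_V[OF assms] by (elim exE conjE) (intro exI conjI)

lemma T_subset: "T S \<subseteq> S"
  by (rule forest_subset)

lemma T_tail:
  assumes "S \<subseteq> E"
  shows "inj_on (tail (T S)) (T S)" "e \<in> T S \<Longrightarrow> tail (T S) e \<in> e"
proof -
  have ed: "\<exists>a b. a \<noteq> b \<and> e = {a, b}" if "e \<in> S" for e
    using edge_doubleton[OF subsetD[OF assms that]] .
  show "inj_on (tail (T S)) (T S)"
    by (rule tail_forest(1)[OF finite_edges[OF assms] inj_on_rk_edges[OF assms] ed])
  show "e \<in> T S \<Longrightarrow> tail (T S) e \<in> e"
    by (rule tail_forest(2)[OF finite_edges[OF assms] inj_on_rk_edges[OF assms] ed])
qed

lemma T_edge:
  assumes "S \<subseteq> E" "e \<in> T S"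
  shows "e = {tail (T S) e, head (T S) e}" "head (T S) e \<noteq> tail (T S) e"
proof -
  have "e \<in> E" using assms T_subset by auto
  from edge_doubleton[OF this] obtain a b where ab: "a \<noteq> b" "e = {a, b}" by (elim exE conjE)
  show "e = {tail (T S) e, head (T S) e}" "head (T S) e \<noteq> tail (T S) e"
    using head_edge[OF ab(1), of "T S"] T_tail(2)[OF assms] ab(2) by auto
qed

abbreviation hist :: "'v set list \<Rightarrow> 'v history pmf" where
  "hist es \<equiv> run A V m w es []"

definition accept_prob :: "'v set list \<Rightarrow> 'v set \<Rightarrow> 'v history \<Rightarrow> real" where
  "accept_prob es e h = (let F = T (set (es @ [e])) in
     if N \<le> length es \<and> e \<in> F \<and> tail F e \<notin> busy V (rev h) \<and> head F e \<notin> busy V (rev h)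
     then cred N \<theta> V (rev h) (head F e) else 0)"

lemma cred_bounds: "0 \<le> cred N \<theta> V r x" "cred N \<theta> V r x \<le> 1"
  by (induction r) (auto simp: \<theta> mult_le_one)

lemma accept_prob_bounds: "0 \<le> accept_prob es e h" "accept_prob es e h \<le> 1"
  by (auto simp: accept_prob_def Let_def cred_bounds)

lemma alg_eq:
  assumes "map fst h = es" "\<forall>(e, x, b) \<in> set h. x = w e"
  shows "A V m h (e, w e) =
    (if accept_prob es e h = 0 then return_pmf False else bernoulli_pmf (accept_prob es e h))"
proof -
  have "seen_forest V ((e, w e, False) # rev h) = T (insert e (fst ` set h))"
    by (subst seen_forest_eq[of _ w]) (use assms in auto)
  also have "fst ` set h = set es" unfolding assms(1)[symmetric] by (rule set_map[symmetric])
  finally have *: "seen_forest V ((e, w e, False) # rev h) = T (set (es @ [e]))" by simp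
  have "length h = length es" using assms by auto
  \<comment> \<open>A credit of 0 leads \<open>alg\<close> into its Bernoulli branch although
    \<open>accept_prob\<close> is 0.\<close>
  moreover have "bernoulli_pmf (0::real) = return_pmf False"
  proof (rule pmf_eqI)
    fix b show "pmf (bernoulli_pmf 0) b = pmf (return_pmf False) b"
      by (cases b) (simp_all add: indicator_def)
  qed
  ultimately show ?thesis
    unfolding A alg_def Let_def accept_prob_def fst_conv snd_conv * by auto
qed

text \<open>The tails in \<open>busy\<close> stem from forests of different times, so the invariant
  keeps only the existence of an injective assignment of tails. This is what
  \<open>acyclic_edges_insert_tail\<close> needs.\<close>

definition good_hist :: "'v set list \<Rightarrow> 'v history \<Rightarrow> bool" where
  "good_hist es h \<longleftrightarrow> map fst h = es \<and> (\<forall>(e, x, b) \<in> set h. x = w e) \<and>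
     acyclic_edges (accepted h) \<and> (length es \<le> N \<longrightarrow> busy V (rev h) = {}) \<and>
     (\<exists>t. inj_on t (accepted h) \<and> (\<forall>e \<in> accepted h. t e \<in> e) \<and> busy V (rev h) = t ` accepted h)"

lemma seen_forest_good:
  assumes "good_hist es h"
  shows "seen_forest V ((e, w e, b) # rev h) = T (set (es @ [e]))"
proof -
  have "seen_forest V ((e, w e, b) # rev h) = T (insert e (fst ` set h))"
    by (subst seen_forest_eq[of _ w]) (use assms in \<open>auto simp: good_hist_def\<close>)
  also have "fst ` set h = set (map fst h)" by (rule set_map[symmetric])
  also have "map fst h = es" using assms by (simp add: good_hist_def)
  finally show ?thesis by simp
qed

text \<open>Neither end of the accepted edge is the tail of an earlier one, so no cycle closes. The
  cycle check in \<open>run\<close> therefore never overrules a decision to accept.\<close>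

lemma good_accept:
  assumes g: "good_hist es h" and d: "distinct (es @ [e])" and E: "set (es @ [e]) \<subseteq> E"
    and p: "accept_prob es e h \<noteq> 0"
  shows "acyclic_edges (insert e (accepted h))" "good_hist (es @ [e]) (h @ [(e, w e, True)])"
proof -
  let ?F = "T (set (es @ [e]))"
  obtain t where t: "inj_on t (accepted h)" "\<And>e. e \<in> accepted h \<Longrightarrow> t e \<in> e"
    "busy V (rev h) = t ` accepted h" using g unfolding good_hist_def by blast
  have F: "N \<le> length es" "e \<in> ?F" "tail ?F e \<notin> busy V (rev h)" "head ?F e \<notin> busy V (rev h)"
    using p by (auto simp: accept_prob_def Let_def split: if_splits)
  note e = T_edge[OF E F(2)]
  have "acyclic_edges (insert {tail ?F e, head ?F e} (accepted h))"
    using g t F e(2) by (intro acyclic_edges_insert_tail[of _ t]) (auto simp: good_hist_def)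
  then show ac: "acyclic_edges (insert e (accepted h))" using e(1) by simp
  have na: "e \<notin> accepted h" using accepted_subset[of h] g d by (auto simp: good_hist_def)
  have b: "busy V (rev (h @ [(e, w e, True)])) = insert (tail ?F e) (busy V (rev h))"
    using seen_forest_good[OF g, of e True] by simp
  define t' where "t' f = (if f = e then tail ?F e else t f)" for f
  have t'e: "t' e = tail ?F e" by (simp add: t'_def)
  have t'h: "t' f = t f" if "f \<in> accepted h" for f using that na by (auto simp: t'_def)
  have im0: "t' ` accepted h = t ` accepted h" using t'h by (rule image_cong[OF refl])
  have im: "t' ` insert e (accepted h) = insert (tail ?F e) (t ` accepted h)"
    unfolding image_insert t'e im0 ..
  have "inj_on t' (accepted h)" by (rule iffD2[OF inj_on_cong[OF t'h] t(1)])
  then have "inj_on t' (insert e (accepted h))"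
    unfolding inj_on_insert t'e using F(3) t(3) na by (simp add: im0)
  moreover have "\<forall>f \<in> insert e (accepted h). t' f \<in> f"
    using t(2) T_tail(2)[OF E F(2)] t'e t'h by simp
  ultimately have "\<exists>t. inj_on t (insert e (accepted h)) \<and> (\<forall>f \<in> insert e (accepted h). t f \<in> f) \<and>
      insert (tail ?F e) (busy V (rev h)) = t ` insert e (accepted h)"
    unfolding t(3) im[symmetric] by blast
  then show "good_hist (es @ [e]) (h @ [(e, w e, True)])"
    using g ac F(1) unfolding good_hist_def b accepted_snoc by auto
qed

lemma good_reject:
  assumes "good_hist es h" shows "good_hist (es @ [e]) (h @ [(e, w e, False)])"
  using assms by (auto simp: good_hist_def accepted_snoc)

lemma good_hist_support:
  assumes "distinct es" "set es \<subseteq> E" "h \<in> set_pmf (hist es)"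
  shows "good_hist es h"
  using assms
proof (induction es arbitrary: h rule: rev_induct)
  case Nil
  then show ?case by (auto simp: good_hist_def accepted_def)
next
  case (snoc e es)
  obtain h' b where h': "h' \<in> set_pmf (hist es)" "b \<in> set_pmf (A V m h' (e, w e))"
    and h: "h = h' @ [(e, w e, b \<and> acyclic_edges (insert e (accepted h')))]"
    using snoc.prems(3) by (auto simp: run_snoc)
  have g: "good_hist es h'" using snoc h' by simp
  then have eq: "A V m h' (e, w e) = (if accept_prob es e h' = 0 then return_pmf False
      else bernoulli_pmf (accept_prob es e h'))"
    by (intro alg_eq) (auto simp: good_hist_def)
  show ?case
  proof (cases b)
    case True
    then have "accept_prob es e h' \<noteq> 0" using h'(2) eq by (auto split: if_splits)
    then show ?thesis using good_accept[OF g snoc.prems(1,2)] True h by simp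
  next
    case False
    then show ?thesis using good_reject[OF g] h by simp
  qed
qed

lemma finite_hist: "finite (set_pmf (hist es))"
  by (induction es rule: rev_induct) (auto simp: run_snoc)

abbreviation Ex :: "'v set list \<Rightarrow> ('v history \<Rightarrow> real) \<Rightarrow> real" where
  "Ex es f \<equiv> measure_pmf.expectation (hist es) f"

lemma Ex_sum: "Ex es f = (\<Sum>h\<in>set_pmf (hist es). pmf (hist es) h * f h)"
  by (subst integral_measure_pmf[OF finite_hist]) auto

lemma Ex_cong:
  assumes "distinct es" "set es \<subseteq> E" "\<And>h. good_hist es h \<Longrightarrow> f h = g h"
  shows "Ex es f = Ex es g"
  unfolding Ex_sum using good_hist_support[OF assms(1,2)] assms(3) by (intro sum.cong) auto

lemma Ex_mono:
  assumes "distinct es" "set es \<subseteq> E" "\<And>h. good_hist es h \<Longrightarrow> f h \<le> g h"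
  shows "Ex es f \<le> Ex es g"
  unfolding Ex_sum using good_hist_support[OF assms(1,2)] assms(3)
  by (intro sum_mono mult_left_mono) auto

lemma Ex_diff: "Ex es (\<lambda>h. f h - g h) = Ex es f - Ex es g"
  unfolding Ex_sum by (simp add: sum_subtractf right_diff_distrib)

lemma Ex_cmult: "Ex es (\<lambda>h. c * f h) = c * Ex es f"
  by simp

lemma Ex_snoc:
  assumes d: "distinct (es @ [e])" and E: "set (es @ [e]) \<subseteq> E"
  shows "Ex (es @ [e]) f = Ex es (\<lambda>h. accept_prob es e h * f (h @ [(e, w e, True)]) +
    (1 - accept_prob es e h) * f (h @ [(e, w e, False)]))"
proof -
  have "Ex (es @ [e]) f = (\<Sum>h\<in>set_pmf (hist es). pmf (hist es) h *
      measure_pmf.expectation (bind_pmf (A V m h (e, w e))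
      (\<lambda>b. return_pmf (h @ [(e, w e, b \<and> acyclic_edges (insert e (accepted h)))]))) f)"
    by (subst run_snoc, subst pmf_expectation_bind[OF finite_hist]) (auto simp: mult.commute)
  also have "\<dots> = (\<Sum>h\<in>set_pmf (hist es). pmf (hist es) h * (accept_prob es e h *
      f (h @ [(e, w e, True)]) + (1 - accept_prob es e h) * f (h @ [(e, w e, False)])))"
  proof (intro sum.cong refl arg_cong2[where f = "(*)"])
    fix h assume "h \<in> set_pmf (hist es)"
    then have g: "good_hist es h" using d E by (intro good_hist_support) auto
    then have eq: "A V m h (e, w e) = (if accept_prob es e h = 0 then return_pmf False
        else bernoulli_pmf (accept_prob es e h))"
      by (intro alg_eq) (auto simp: good_hist_def)
    have "measure_pmf.expectation (bind_pmf (A V m h (e, w e))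
        (\<lambda>b. return_pmf (h @ [(e, w e, b \<and> acyclic_edges (insert e (accepted h)))]))) f =
      measure_pmf.expectation (A V m h (e, w e))
        (\<lambda>b. f (h @ [(e, w e, b \<and> acyclic_edges (insert e (accepted h)))]))"
      by (subst map_pmf_def[symmetric]) simp
    also have "\<dots> = accept_prob es e h * f (h @ [(e, w e, True)]) +
        (1 - accept_prob es e h) * f (h @ [(e, w e, False)])"
      using eq good_accept(1)[OF g d E] accept_prob_bounds[of es e h] by auto
    finally show "measure_pmf.expectation (bind_pmf (A V m h (e, w e))
        (\<lambda>b. return_pmf (h @ [(e, w e, b \<and> acyclic_edges (insert e (accepted h)))]))) f =
      accept_prob es e h * f (h @ [(e, w e, True)]) +
        (1 - accept_prob es e h) * f (h @ [(e, w e, False)])" .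
  qed
  finally show ?thesis unfolding Ex_sum[of es] .
qed

text \<open>The credit-weighted indicator that all vertices of \<open>W\<close> are free.
  \<open>W\<close> is a list, so a repeated vertex contributes its credit once per
  occurrence.\<close>

definition val :: "'v list \<Rightarrow> 'v history \<Rightarrow> real" where
  "val W h = (if busy V (rev h) \<inter> set W = {} then prod_list (map (cred N \<theta> V (rev h)) W) else 0)"

definition roots :: "'v set set \<Rightarrow> 'v list \<Rightarrow> 'v list" where
  "roots S W = filter (\<lambda>x. x \<notin> tail (T S) ` T S) W"

lemma prod_list_cred_nonneg: "0 \<le> prod_list (map (cred N \<theta> V r) W)"
  by (induction W) (auto intro: cred_bounds mult_nonneg_nonneg)

lemma val_Cons_le: "val (x # W) h \<le> val W h"
  using prod_list_cred_nonneg[of "rev h" W] cred_bounds[of "rev h" x]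
  by (auto simp: val_def mult_left_le_one_le)

lemma cred_early: "length r \<le> N \<Longrightarrow> cred N \<theta> V r x = 1"
  by (induction r) auto

lemma val_early:
  assumes "good_hist es h" "length es \<le> N" shows "val W h = 1"
proof -
  have "length h = length es" using assms by (auto simp: good_hist_def)
  then have "cred N \<theta> V (rev h) x = 1" for x
    using cred_early[of "rev h"] assms(2) by simp
  then have "prod_list (map (cred N \<theta> V (rev h)) W) = 1" by (induction W) auto
  then show ?thesis using assms by (simp add: val_def good_hist_def)
qed

lemma prod_list_cred_step:
  assumes "good_hist es h" "N \<le> length es"
  shows "prod_list (map (cred N \<theta> V (rev (h @ [(e, w e, b)]))) W) =
    \<theta> (Suc (length es)) ^ length (roots (set (es @ [e])) W) * prod_list (map (cred N \<theta> V (rev h)) W)"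
proof -
  have "length h = length es" using assms by (auto simp: good_hist_def)
  then have "cred N \<theta> V (rev (h @ [(e, w e, b)])) x = cred N \<theta> V (rev h) x *
      (if x \<in> tail (T (set (es @ [e]))) ` T (set (es @ [e])) then 1 else \<theta> (Suc (length es)))" for x
    using assms(2) seen_forest_good[OF assms(1), of e b] by simp
  then have "map (cred N \<theta> V (rev (h @ [(e, w e, b)]))) W = map (\<lambda>x. cred N \<theta> V (rev h) x *
      (if x \<in> tail (T (set (es @ [e]))) ` T (set (es @ [e])) then 1 else \<theta> (Suc (length es)))) W"
    by (intro map_cong refl)
  also have "prod_list \<dots> = \<theta> (Suc (length es)) ^ length (roots (set (es @ [e])) W) *
      prod_list (map (cred N \<theta> V (rev h)) W)"
    unfolding roots_def prod_list_if_power[symmetric] by (induction W) simp_all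
  finally show ?thesis .
qed

text \<open>If the tail of \<open>e\<close> lies in \<open>W\<close>, acceptance reduces
  \<open>val W\<close> to 0. It happens with probability the credit of the head if both ends are
  free, and this probability times \<open>val W\<close> is \<open>val\<close> of the list extended
  by the head. The power of \<open>\<theta>\<close> is the credit lost by the roots in
  \<open>W\<close>.\<close>

lemma Ex_val_snoc:
  assumes d: "distinct (es @ [e])" and E: "set (es @ [e]) \<subseteq> E" and N: "N \<le> length es"
    and F: "F = T (set (es @ [e]))"
  shows "Ex (es @ [e]) (val W) = \<theta> (Suc (length es)) ^ length (roots (set (es @ [e])) W) *
    (Ex es (val W) - (if e \<in> F \<and> tail F e \<in> set W then Ex es (val (head F e # W)) else 0))"
proof -
  let ?c = "\<theta> (Suc (length es)) ^ length (roots (set (es @ [e])) W)"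
  have step: "accept_prob es e h * val W (h @ [(e, w e, True)]) +
      (1 - accept_prob es e h) * val W (h @ [(e, w e, False)]) =
      ?c * (val W h - (if e \<in> F \<and> tail F e \<in> set W then val (head F e # W) h else 0))"
    if g: "good_hist es h" for h
  proof -
    have bT: "busy V (rev (h @ [(e, w e, True)])) = insert (tail F e) (busy V (rev h))"
      using seen_forest_good[OF g, of e True] F by simp
    have bF: "busy V (rev (h @ [(e, w e, False)])) = busy V (rev h)" by simp
    have vF: "val W (h @ [(e, w e, False)]) = ?c * val W h"
      unfolding val_def bF prod_list_cred_step[OF g N] by simp
    have vT: "val W (h @ [(e, w e, True)]) = (if tail F e \<in> set W then 0 else ?c * val W h)"
      unfolding val_def bT prod_list_cred_step[OF g N] by simp
    show ?thesis
    proof (cases "e \<in> F \<and> tail F e \<in> set W")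
      case True
      then have "accept_prob es e h * val W h = val (head F e # W) h"
        using N unfolding accept_prob_def Let_def F[symmetric] val_def by auto
      then show ?thesis using True unfolding vF vT by (simp add: algebra_simps)
    next
      case False
      then have "accept_prob es e h = 0 \<or> tail F e \<notin> set W"
        unfolding accept_prob_def Let_def F[symmetric] by auto
      then show ?thesis using False unfolding vF vT by (auto simp: algebra_simps)
    qed
  qed
  have es: "distinct es" "set es \<subseteq> E" using d E by auto
  have "Ex (es @ [e]) (val W) =
      Ex es (\<lambda>h. ?c * (val W h - (if e \<in> F \<and> tail F e \<in> set W then val (head F e # W) h else 0)))"
    unfolding Ex_snoc[OF d E] by (rule Ex_cong[OF es step])
  also have "\<dots> = ?c * (Ex es (val W) - Ex es (\<lambda>h. if e \<in> F \<and> tail F e \<in> set W then val (head F e # W) h else 0))"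
    unfolding Ex_cmult Ex_diff ..
  finally show ?thesis by (cases "e \<in> F"; cases "tail F e \<in> set W") simp_all
qed

section \<open>Averages over the arrival orders of a given edge set\<close>

definition avg :: "('v history \<Rightarrow> real) \<Rightarrow> 'v set set \<Rightarrow> real" where
  "avg f S = (\<Sum>l\<in>permutations_of_set S. Ex l f) / fact (card S)"

lemma avg_mono:
  assumes "S \<subseteq> E" "\<And>es h. set es = S \<Longrightarrow> distinct es \<Longrightarrow> good_hist es h \<Longrightarrow> f h \<le> g h"
  shows "avg f S \<le> avg g S"
  unfolding avg_def
proof (intro divide_right_mono sum_mono)
  fix l assume "l \<in> permutations_of_set S"
  note l = permutations_of_setD[OF this]
  show "Ex l f \<le> Ex l g"
    using l assms by (intro Ex_mono) auto
qed simp

lemma avg_const: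
  assumes "S \<subseteq> E" shows "avg (\<lambda>_. c) S = c"
  using finite_edges[OF assms] by (simp add: avg_def)

text \<open>The quantity P_k of the overview for the \<open>k\<close> entries of \<open>W\<close>,
  conditioned on the event that the edges seen so far are those of \<open>S\<close>.\<close>

definition Fv :: "'v list \<Rightarrow> 'v set set \<Rightarrow> real" where
  "Fv W S = avg (val W) S"

lemma Fv_Cons_le: "S \<subseteq> E \<Longrightarrow> Fv (x # W) S \<le> Fv W S"
  unfolding Fv_def by (intro avg_mono val_Cons_le)

lemma Fv_early:
  assumes "S \<subseteq> E" "card S \<le> N" shows "Fv W S = 1"
proof -
  have v: "val W h = 1" if "set es = S" "distinct es" "good_hist es h" for es h
    using that assms(2) distinct_card[of es] by (intro val_early) auto
  have "avg (val W) S \<le> avg (\<lambda>_. 1) S" "avg (\<lambda>_. 1) S \<le> avg (val W) S"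
    using v by (intro avg_mono[OF assms(1)]; simp)+
  then show ?thesis using avg_const[OF assms(1), of 1] by (simp add: Fv_def)
qed

text \<open>The last arrival is uniform in \<open>S\<close>, and given that it is \<open>e\<close>,
  the earlier ones are in a uniformly random order of \<open>S - {e}\<close>.\<close>

lemma avg_Suc:
  assumes S: "S \<subseteq> E" "card S = Suc s"
    and step: "\<And>e l. e \<in> S \<Longrightarrow> distinct (l @ [e]) \<Longrightarrow> set (l @ [e]) = S \<Longrightarrow> set l = S - {e} \<Longrightarrow>
      length l = s \<Longrightarrow> Ex (l @ [e]) f = Ex l (g e)"
  shows "avg f S = (\<Sum>e\<in>S. avg (g e) (S - {e})) / Suc s"
proof -
  have fin: "finite S" using finite_edges S by blast
  have ne: "S \<noteq> {}" using S by auto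
  have "(\<Sum>l\<in>permutations_of_set S. Ex l f) =
      (\<Sum>e\<in>S. \<Sum>l\<in>permutations_of_set (S - {e}). Ex (l @ [e]) f)"
    by (rule sum_permutations_snoc[OF fin ne])
  also have "\<dots> = (\<Sum>e\<in>S. \<Sum>l\<in>permutations_of_set (S - {e}). Ex l (g e))"
  proof (intro sum.cong refl)
    fix e l assume e: "e \<in> S" and "l \<in> permutations_of_set (S - {e})"
    note l = permutations_of_setD[OF this(2)]
    have "length l = s" using l e S fin distinct_card[of l] by simp
    then show "Ex (l @ [e]) f = Ex l (g e)"
      using l e by (intro step) (simp_all add: insert_absorb)
  qed
  also have "\<dots> = (\<Sum>e\<in>S. fact s * avg (g e) (S - {e}))"
    using S fin by (intro sum.cong refl) (simp add: avg_def)
  finally have "(\<Sum>l\<in>permutations_of_set S. Ex l f) = fact s * (\<Sum>e\<in>S. avg (g e) (S - {e}))"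
    unfolding sum_distrib_left .
  then show ?thesis unfolding avg_def[of f S] S(2) by simp
qed

lemma avg_diff: "avg (\<lambda>h. f h - g h) S = avg f S - avg g S"
  by (simp add: avg_def Ex_diff sum_subtractf diff_divide_distrib)

lemma avg_cmult: "avg (\<lambda>h. c * f h) S = c * avg f S"
  by (simp add: avg_def sum_distrib_left[symmetric])

lemma Fv_Suc:
  assumes S: "S \<subseteq> E" "card S = Suc s" and N: "N \<le> s"
  shows "Fv W S = \<theta> (Suc s) ^ length (roots S W) * (\<Sum>e\<in>S. Fv W (S - {e}) -
    (if e \<in> T S \<and> tail (T S) e \<in> set W then Fv (head (T S) e # W) (S - {e}) else 0)) / Suc s"
proof -
  let ?c = "\<theta> (Suc s) ^ length (roots S W)"
  let ?g = "\<lambda>e h. ?c * (val W h -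
    (if e \<in> T S \<and> tail (T S) e \<in> set W then 1 else 0) * val (head (T S) e # W) h)"
  have "Ex (l @ [e]) (val W) = Ex l (?g e)"
    if "distinct (l @ [e])" "set (l @ [e]) = S" "length l = s" for l e
    using Ex_val_snoc[OF that(1) _ _ refl, of W] S(1) N
    unfolding that(2,3) Ex_cmult Ex_diff by (auto split: if_splits)
  then have "avg (val W) S = (\<Sum>e\<in>S. avg (?g e) (S - {e})) / Suc s"
    by (intro avg_Suc[OF S])
  then show ?thesis
    unfolding avg_cmult avg_diff Fv_def
    by (simp add: sum_distrib_left[symmetric] if_distrib[of "\<lambda>x. x * _"] cong: if_cong)
qed

section \<open>Probability that a fixed edge is accepted\<close>

definition wins :: "'v set \<Rightarrow> 'v history \<Rightarrow> real" where
  "wins e h = of_bool (e \<in> accepted h)"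

text \<open>Conditioning on the last arrival \<open>f\<close>: either \<open>e\<close> came earlier
  and its fate is already decided, or \<open>f = e\<close>, and after the sampling phase it is
  accepted if both ends are free and the credit of the head admits it.\<close>

lemma avg_wins_Suc:
  assumes S: "S \<subseteq> E" "card S = Suc s" and e: "e \<in> T S" "e = {u, v}" "u \<noteq> v"
  shows "(\<Sum>f\<in>S - {e}. avg (wins e) (S - {f})) + (if N \<le> s then Fv [u, v] (S - {e}) else 0)
    \<le> Suc s * avg (wins e) S"
proof -
  have fin: "finite S" using finite_edges S by blast
  have eS: "e \<in> S" using e(1) T_subset by blast
  let ?F = "T S"
  define p where "p h = (if N \<le> s \<and> tail ?F e \<notin> busy V (rev h) \<and> head ?F e \<notin> busy V (rev h)
     then cred N \<theta> V (rev h) (head ?F e) else 0)" for h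
  define g where "g f = (if f = e then p else wins e)" for f
  have st: "Ex (l @ [f]) (wins e) = Ex l (g f)"
    if l: "distinct (l @ [f])" "set (l @ [f]) = S" "set l = S - {f}" "length l = s" for l f
  proof -
    have LE: "set (l @ [f]) \<subseteq> E" using l S by simp
    show ?thesis
      unfolding Ex_snoc[OF l(1) LE]
    proof (intro Ex_cong)
      fix h assume h: "good_hist l h"
      show "accept_prob l f h * wins e (h @ [(f, w f, True)]) +
          (1 - accept_prob l f h) * wins e (h @ [(f, w f, False)]) = g f h"
      proof (cases "f = e")
        case True
        have "fst ` set h = set l" using h unfolding good_hist_def by (metis set_map)
        then have "e \<notin> accepted h" using accepted_subset[of h] l True by auto
        moreover have "accept_prob l e h = p h"
          using True l e(1) unfolding accept_prob_def p_def Let_def by auto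
        ultimately show ?thesis using True by (simp add: wins_def g_def accepted_snoc)
      next
        case False
        then show ?thesis by (simp add: wins_def g_def accepted_snoc)
      qed
    qed (use l LE in auto)
  qed
  have "avg (wins e) S = (\<Sum>f\<in>S. avg (g f) (S - {f})) / Suc s"
    by (intro avg_Suc[OF S] st)
  also have "(\<Sum>f\<in>S. avg (g f) (S - {f})) = avg p (S - {e}) + (\<Sum>f\<in>S - {e}. avg (wins e) (S - {f}))"
    unfolding sum.remove[OF fin eS] by (simp add: g_def)
  finally have eq: "Suc s * avg (wins e) S =
      avg p (S - {e}) + (\<Sum>f\<in>S - {e}. avg (wins e) (S - {f}))" by simp
  have SE: "S - {e} \<subseteq> E" using S by blast
  have th: "{tail ?F e, head ?F e} = {u, v}" using T_edge(1)[OF S(1) e(1)] e(2) by simp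
  then have uv: "tail ?F e = u \<and> head ?F e = v \<or> tail ?F e = v \<and> head ?F e = u"
    by (auto simp: doubleton_eq_iff)
  \<comment> \<open>The acceptance probability contains the credit of the head only,
    \<open>val [u, v]\<close> those of both ends. As credits are at most 1, the bound holds for
    either orientation of \<open>e\<close>.\<close>
  have "val [u, v] h \<le> p h" if "N \<le> s" for h
    using uv that cred_bounds[of "rev h" u] cred_bounds[of "rev h" v]
    by (auto simp: val_def p_def mult_left_le mult_left_le_one_le)
  then have "Fv [u, v] (S - {e}) \<le> avg p (S - {e})" if "N \<le> s"
    unfolding Fv_def using that by (intro avg_mono[OF SE]) auto
  moreover have "avg (\<lambda>_. 0) (S - {e}) \<le> avg p (S - {e})"
    by (intro avg_mono[OF SE]) (auto simp: p_def cred_bounds)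
  ultimately show ?thesis unfolding eq using avg_const[OF SE, of 0] by auto
qed

lemma expected_ALG_eq:
  assumes m: "m = card E"
  shows "expected_ALG A V E w = (\<Sum>e\<in>E. w e * avg (wins e) E)"
proof -
  have fin: "finite E" by (simp add: finite_edges)
  have "expected_ALG A V E w = (\<Sum>l\<in>permutations_of_set E.
      Ex l (\<lambda>h. \<Sum>e\<in>accepted h. w e) / fact (card E))"
    unfolding expected_ALG_def unfolding m[symmetric]
    by (subst pmf_expectation_bind_pmf_of_set)
      (auto simp: fin finite_hist m[symmetric] divide_inverse mult.commute)
  also have "\<dots> = (\<Sum>l\<in>permutations_of_set E. (\<Sum>e\<in>E. w e * Ex l (wins e)) / fact (card E))"
  proof (intro sum.cong refl arg_cong2[where f = "(/)"])
    fix l assume "l \<in> permutations_of_set E"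
    note l = permutations_of_setD[OF this]
    have "Ex l (\<lambda>h. \<Sum>e\<in>accepted h. w e) = Ex l (\<lambda>h. \<Sum>e\<in>E. w e * wins e h)"
    proof (rule Ex_cong)
      fix h assume "good_hist l h"
      then have "fst ` set h = E" unfolding good_hist_def using l by (metis set_map)
      then have sub: "accepted h \<subseteq> E" using accepted_subset by blast
      have "(\<Sum>e\<in>E. w e * wins e h) = (\<Sum>e\<in>E. if e \<in> accepted h then w e else 0)"
        by (intro sum.cong) (auto simp: wins_def)
      also have "\<dots> = (\<Sum>e\<in>accepted h. w e)"
        using sub fin by (simp add: sum.inter_restrict[symmetric] Int_absorb1)
      finally show "(\<Sum>e\<in>accepted h. w e) = (\<Sum>e\<in>E. w e * wins e h)" ..
    qed (use l in auto)
    also have "\<dots> = (\<Sum>e\<in>E. w e * Ex l (wins e))"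
      by (simp add: Bochner_Integration.integral_sum integrable_measure_pmf_finite[OF finite_hist])
    finally show "Ex l (\<lambda>h. \<Sum>e\<in>accepted h. w e) = (\<Sum>e\<in>E. w e * Ex l (wins e))" .
  qed
  also have "\<dots> = (\<Sum>e\<in>E. w e * avg (wins e) E)"
    unfolding avg_def sum_divide_distrib sum_distrib_left by (subst sum.swap) simp
  finally show ?thesis .
qed

end

subsection \<open>Bounds on the probability that vertices are free\<close>

text \<open>The survival probability of \<open>k\<close> vertices if step \<open>j\<close> hits each
  with probability \<open>1 / j\<close> and never two at once; roughly \<open>(N / s) ^ k\<close>.
  The truncation by \<open>max 0\<close> acts only on factors with \<open>j < k\<close>.\<close>

definition surv :: "nat \<Rightarrow> nat \<Rightarrow> nat \<Rightarrow> real" where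
  "surv k N s = (\<Prod>j\<in>{N<..s}. max 0 (1 - real k / real j))"

lemma surv_Suc: "N \<le> s \<Longrightarrow> surv k N (Suc s) = surv k N s * max 0 (1 - real k / real (Suc s))"
proof -
  assume "N \<le> s"
  then have "{N<..Suc s} = insert (Suc s) {N<..s}" by auto
  then show ?thesis by (simp add: surv_def mult.commute)
qed

lemma surv_self [simp]: "surv k N N = 1"
  by (simp add: surv_def)

lemma surv_nonneg: "0 \<le> surv k N s"
  by (simp add: surv_def prod_nonneg)

lemma surv_le_1: "surv k N s \<le> 1"
  unfolding surv_def by (intro prod_le_1) auto

lemma sum_if_card:
  assumes "finite S" "H \<subseteq> S"
  shows "(\<Sum>e\<in>S. if e \<in> H then x else y) = real (card H) * x + (real (card S) - real (card H)) * (y :: real)"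
proof -
  have "card (S - H) = card S - card H" "card H \<le> card S"
    using assms by (auto simp: card_Diff_subset finite_subset card_mono)
  moreover have "S \<inter> {e. e \<in> H} = H" "S \<inter> - {e. e \<in> H} = S - H" using assms by auto
  ultimately show ?thesis using assms(1) by (simp add: sum.If_cases of_nat_diff)
qed

context online_forest
begin

definition hits :: "'v set set \<Rightarrow> 'v list \<Rightarrow> 'v set set" where
  "hits S W = {e \<in> T S. tail (T S) e \<in> set W}"

lemma hits_subset: "hits S W \<subseteq> S"
  using T_subset by (auto simp: hits_def)

text \<open>Tails are distinct, so every vertex of \<open>W\<close> that is not a root is hit by
  exactly one edge of the forest. Repetitions in \<open>W\<close> only make the left side
  smaller.\<close>

lemma card_hits:
  assumes "S \<subseteq> E"
  shows "card (hits S W) + length (roots S W) \<le> length W"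
    and "distinct W \<Longrightarrow> card (hits S W) + length (roots S W) = length W"
proof -
  let ?P = "\<lambda>x. x \<in> tail (T S) ` T S"
  have "card (hits S W) = card (tail (T S) ` hits S W)"
    by (intro card_image[symmetric] inj_on_subset[OF T_tail(1)[OF assms]]) (auto simp: hits_def)
  also have "tail (T S) ` hits S W = set (filter ?P W)" by (auto simp: hits_def)
  finally have *: "card (hits S W) = card (set (filter ?P W))" .
  have "length (filter ?P W) + length (roots S W) = length W"
    unfolding roots_def by (rule sum_length_filter_compl)
  then show "card (hits S W) + length (roots S W) \<le> length W"
    "distinct W \<Longrightarrow> card (hits S W) + length (roots S W) = length W"
    using card_length[of "filter ?P W"] distinct_card[of "filter ?P W"] unfolding *
    by (simp_all del: set_filter)
qed

lemma Fv_step: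
  assumes S: "S \<subseteq> E" "card S = Suc s" and N: "N \<le> s"
  shows "Fv W S = \<theta> (Suc s) ^ length (roots S W) * ((\<Sum>e\<in>S. Fv W (S - {e}) -
    (if e \<in> hits S W then Fv (head (T S) e # W) (S - {e}) else 0)) / Suc s)"
  unfolding Fv_Suc[OF assms] by (simp add: hits_def)

lemma Fv_step_ge:
  assumes S: "S \<subseteq> E" "card S = Suc s" and N: "N \<le> s"
    and hit: "\<And>e. e \<in> hits S W \<Longrightarrow> x \<le> Fv W (S - {e}) - Fv (head (T S) e # W) (S - {e})"
    and miss: "\<And>e. e \<in> S \<Longrightarrow> e \<notin> hits S W \<Longrightarrow> y \<le> Fv W (S - {e})"
  shows "\<theta> (Suc s) ^ length (roots S W) *
    (y - real (card (hits S W)) * (y - x) / Suc s) \<le> Fv W S"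
proof -
  have "(\<Sum>e\<in>S. if e \<in> hits S W then x else y) \<le> (\<Sum>e\<in>S. Fv W (S - {e}) -
      (if e \<in> hits S W then Fv (head (T S) e # W) (S - {e}) else 0))"
    using hit miss by (intro sum_mono) auto
  then have "real (card (hits S W)) * x + (real (Suc s) - real (card (hits S W))) * y \<le> (\<Sum>e\<in>S. Fv W (S - {e}) -
      (if e \<in> hits S W then Fv (head (T S) e # W) (S - {e}) else 0))"
    unfolding sum_if_card[OF finite_edges[OF S(1)] hits_subset] S(2) .
  then have "(real (card (hits S W)) * x + (real (Suc s) - real (card (hits S W))) * y) / Suc s \<le>
      (\<Sum>e\<in>S. Fv W (S - {e}) - (if e \<in> hits S W then Fv (head (T S) e # W) (S - {e}) else 0)) / Suc s"
    by (rule divide_right_mono) simp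
  moreover have "(real (card (hits S W)) * x + (real (Suc s) - real (card (hits S W))) * y) / Suc s =
      y - real (card (hits S W)) * (y - x) / Suc s"
    by (simp add: field_simps)
  ultimately show ?thesis unfolding Fv_step[OF S N] using \<theta> by (intro mult_left_mono) auto
qed

lemma Fv_step_le:
  assumes S: "S \<subseteq> E" "card S = Suc s" and N: "N \<le> s"
    and hit: "\<And>e. e \<in> hits S W \<Longrightarrow> Fv W (S - {e}) - Fv (head (T S) e # W) (S - {e}) \<le> x"
    and miss: "\<And>e. e \<in> S \<Longrightarrow> e \<notin> hits S W \<Longrightarrow> Fv W (S - {e}) \<le> y"
  shows "Fv W S \<le> \<theta> (Suc s) ^ length (roots S W) *
    (y - real (card (hits S W)) * (y - x) / Suc s)"
proof -
  have "(\<Sum>e\<in>S. Fv W (S - {e}) -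
      (if e \<in> hits S W then Fv (head (T S) e # W) (S - {e}) else 0)) \<le> (\<Sum>e\<in>S. if e \<in> hits S W then x else y)"
    using hit miss by (intro sum_mono) auto
  then have "(\<Sum>e\<in>S. Fv W (S - {e}) -
      (if e \<in> hits S W then Fv (head (T S) e # W) (S - {e}) else 0)) \<le> real (card (hits S W)) * x + (real (Suc s) - real (card (hits S W))) * y"
    unfolding sum_if_card[OF finite_edges[OF S(1)] hits_subset] S(2) .
  then have "(\<Sum>e\<in>S. Fv W (S - {e}) - (if e \<in> hits S W then Fv (head (T S) e # W) (S - {e}) else 0)) / Suc s
      \<le> (real (card (hits S W)) * x + (real (Suc s) - real (card (hits S W))) * y) / Suc s"
    by (rule divide_right_mono) simp
  moreover have "(real (card (hits S W)) * x + (real (Suc s) - real (card (hits S W))) * y) / Suc s =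
      y - real (card (hits S W)) * (y - x) / Suc s"
    by (simp add: field_simps)
  ultimately show ?thesis unfolding Fv_step[OF S N] using \<theta> by (intro mult_left_mono) auto
qed

text \<open>With \<open>n = s + 1\<close>, a hit loses at most everything and has probability
  \<open>1 / n\<close> per non-root, while a root loses at most a fraction \<open>1 / n\<close> of
  its credit. So each entry of \<open>W\<close> costs at most a fraction \<open>1 / n\<close>, where
  several roots are combined by Bernoulli's inequality.\<close>

lemma Fv_ge_surv:
  assumes \<theta>1: "\<And>s. 1 - 1 / real s \<le> \<theta> s" and "N \<le> s" "card S = s" "S \<subseteq> E"
  shows "surv (length W) N s \<le> Fv W S"
  using assms(2-)
proof (induction s arbitrary: S W rule: nat_induct_at_least)
  case base
  then show ?case using Fv_early[of S W] by simp
next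
  case (Suc s)
  let ?n = "real (Suc s)" and ?d = "real (card (hits S W))" and ?z = "length (roots S W)"
    and ?a = "surv (length W) N s"
  have fin: "finite S" using finite_edges Suc.prems by blast
  have card: "card (S - {e}) = s" "S - {e} \<subseteq> E" if "e \<in> S" for e
    using that Suc.prems fin by (auto simp: card_Diff_singleton Suc.prems(1))
  have miss: "?a \<le> Fv W (S - {e})" if "e \<in> S" for e
    using Suc.IH[of "S - {e}" W] card[OF that] by simp
  have hit: "0 \<le> Fv W (S - {e}) - Fv (head (T S) e # W) (S - {e})" if "e \<in> hits S W" for e
    using Fv_Cons_le[of "S - {e}"] Suc.prems by auto
  have ge: "\<theta> (Suc s) ^ ?z * (?a - ?d * (?a - 0) / ?n) \<le> Fv W S"
    using Suc.prems Suc.hyps hit miss by (intro Fv_step_ge) auto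
  have dn: "?d \<le> ?n" using card_mono[OF fin hits_subset, of W] Suc.prems(1) by linarith
  have zd: "real ?z + ?d \<le> real (length W)" using card_hits(1)[OF Suc.prems(2), of W] by linarith
  have "1 - real ?z / ?n \<le> (1 - 1 / ?n) ^ ?z"
    using Bernoulli_inequality[of "- 1 / ?n" ?z] by (simp add: field_simps)
  also have "\<dots> \<le> \<theta> (Suc s) ^ ?z" using \<theta>1[of "Suc s"] by (intro power_mono) (auto simp: field_simps)
  finally have z: "1 - real ?z / ?n \<le> \<theta> (Suc s) ^ ?z" .
  have "1 - real (length W) / ?n \<le> 1 - (real ?z + ?d) / ?n"
    using zd by (intro diff_left_mono divide_right_mono) auto
  also have "\<dots> \<le> (1 - real ?z / ?n) * (1 - ?d / ?n)" by (simp add: algebra_simps add_divide_distrib)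
  also have "\<dots> \<le> \<theta> (Suc s) ^ ?z * (1 - ?d / ?n)"
    using z dn by (intro mult_right_mono) (auto simp: field_simps)
  finally have "1 - real (length W) / ?n \<le> \<theta> (Suc s) ^ ?z * (1 - ?d / ?n)" .
  moreover have "0 \<le> \<theta> (Suc s) ^ ?z * (1 - ?d / ?n)"
    using dn by (intro mult_nonneg_nonneg zero_le_power \<theta>) (simp add: field_simps)
  ultimately have "max 0 (1 - real (length W) / ?n) \<le> \<theta> (Suc s) ^ ?z * (1 - ?d / ?n)"
    by simp
  then have "?a * max 0 (1 - real (length W) / ?n) \<le> ?a * (\<theta> (Suc s) ^ ?z * (1 - ?d / ?n))"
    by (rule mult_left_mono) (rule surv_nonneg)
  also have "\<dots> = \<theta> (Suc s) ^ ?z * (?a - ?d * (?a - 0) / ?n)" by (simp add: algebra_simps)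
  also note ge
  finally show ?case using Suc.hyps by (simp add: surv_Suc)
qed

end

text \<open>Here \<open>z\<close> counts roots and \<open>d\<close> counts vertices that can be hit.
  As \<open>\<kappa> * U = a\<close>, a root lowers \<open>U\<close> by \<open>a / n\<close> to
  first order, just as a hit does on average. The second-order terms are at most
  \<open>3 * a / n^2\<close>, which the factor \<open>1 - 1 / n\<close> absorbs.\<close>

lemma penalised_upper:
  fixes U a \<kappa> n :: real
  assumes "z + d = 3" "\<kappa> * U = a" "0 \<le> \<kappa>" "\<kappa> \<le> 1" "0 \<le> a" "1 \<le> n"
  shows "(1 - \<kappa> / n) ^ z * (U - real d * a / n) \<le> U - 3 / n * (1 - 1 / n) * a"
proof -
  define r where "r = 1 / n"
  have r: "0 \<le> r" "r \<le> 1" using assms(6) by (auto simp: r_def)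
  have ka: "\<kappa> * a \<le> a" using assms by (simp add: mult_left_le_one_le)
  have kr: "r\<^sup>2 * (\<kappa> * a) \<le> r\<^sup>2 * a" using ka by (intro mult_left_mono) auto
  have nn: "0 \<le> r ^ 3 * \<kappa>\<^sup>2 * a" "0 \<le> r\<^sup>2 * a" using r assms by simp_all
  have goal: "(1 - \<kappa> * r) ^ z * (U - real d * a * r) \<le> U - 3 * r * (1 - r) * a"
  proof -
    consider "z = 0" "d = 3" | "z = 1" "d = 2" | "z = 2" "d = 1" | "z = 3" "d = 0"
      using assms(1) by linarith
    then show ?thesis
    proof cases
      case 1
      have "0 \<le> r\<^sup>2 * a" using assms by simp
      then show ?thesis using 1 by (simp add: algebra_simps power2_eq_square)
    next
      case 2
      have "(1 - \<kappa> * r) * (U - 2 * a * r) = U - 3 * (r * a) + 2 * (r\<^sup>2 * (\<kappa> * a))"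
        by (simp add: assms(2)[symmetric] algebra_simps power2_eq_square)
      also have "\<dots> \<le> U - 3 * (r * a) + 3 * (r\<^sup>2 * a)"
        using kr nn by linarith
      finally show ?thesis using 2 by (simp add: algebra_simps power2_eq_square)
    next
      case 3
      have "(1 - \<kappa> * r)\<^sup>2 * (U - a * r) =
          U - 3 * (r * a) + 3 * (r\<^sup>2 * (\<kappa> * a)) - r ^ 3 * \<kappa>\<^sup>2 * a"
        by (simp add: assms(2)[symmetric] algebra_simps power2_eq_square power3_eq_cube)
      also have "\<dots> \<le> U - 3 * (r * a) + 3 * (r\<^sup>2 * a)"
        using kr nn by linarith
      finally show ?thesis using 3 by (simp add: algebra_simps power2_eq_square)
    next
      case 4
      have "(1 - \<kappa> * r) ^ 3 * U =
          U - 3 * (r * a) + 3 * (r\<^sup>2 * (\<kappa> * a)) - r ^ 3 * \<kappa>\<^sup>2 * a"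
        by (simp add: assms(2)[symmetric] algebra_simps power2_eq_square power3_eq_cube)
      also have "\<dots> \<le> U - 3 * (r * a) + 3 * (r\<^sup>2 * a)"
        using kr nn by linarith
      finally show ?thesis using 4 by (simp add: algebra_simps power2_eq_square)
    qed
  qed
  show ?thesis using goal by (simp add: r_def)
qed

text \<open>As \<open>\<kappa> * L \<le> U\<close>, a root costs to first order at most
  \<open>U / n\<close>, the average cost of a hit; the second-order terms help unless
  \<open>L\<close> is negative.\<close>

lemma penalised_lower:
  fixes U L \<kappa> n :: real
  assumes "z + d = 2" "\<kappa> * L \<le> U" "0 \<le> \<kappa>" "\<kappa> \<le> 1" "0 \<le> U" "1 \<le> n"
  shows "L - 2 / n * U \<le> (1 - \<kappa> / n) ^ z * (L - real d * U / n)"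
proof -
  define r where "r = 1 / n"
  have r: "0 \<le> r" "r \<le> 1" using assms(6) by (auto simp: r_def)
  have rk: "r * (\<kappa> * L) \<le> r * U" using assms(2) r by (intro mult_left_mono) auto
  have "L - 2 * r * U \<le> (1 - \<kappa> * r) ^ z * (L - real d * U * r)"
  proof -
    consider "z = 0" "d = 2" | "z = 1" "d = 1" | "z = 2" "d = 0"
      using assms(1) by linarith
    then show ?thesis
    proof cases
      case 1
      then show ?thesis by (simp add: algebra_simps)
    next
      case 2
      have "0 \<le> \<kappa> * r * (U * r)" using assms r by simp
      moreover have "(1 - \<kappa> * r) * (L - U * r) = L - U * r - r * (\<kappa> * L) + \<kappa> * r * (U * r)"
        by (simp add: algebra_simps)
      ultimately show ?thesis using 2 rk by (simp add: algebra_simps)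
    next
      case 3
      have eq: "(1 - \<kappa> * r)\<^sup>2 * L = L - 2 * (r * (\<kappa> * L)) + (\<kappa> * r)\<^sup>2 * L"
        by (simp add: algebra_simps power2_eq_square)
      show ?thesis
      proof (cases "0 \<le> L")
        case True
        then have "0 \<le> (\<kappa> * r)\<^sup>2 * L" by simp
        then show ?thesis using 3 eq rk by (simp add: algebra_simps)
      next
        \<comment> \<open>Shrinking a negative \<open>L\<close> towards 0 only increases it.\<close>
        case False
        have "(1 - \<kappa> * r)\<^sup>2 \<le> 1"
          using assms r by (intro power_le_one) (auto simp: mult_le_one)
        then have "L \<le> (1 - \<kappa> * r)\<^sup>2 * L" using False by (simp add: mult_le_cancel_right1)
        moreover have "0 \<le> 2 * r * U" using r assms by simp
        ultimately have "L - 2 * r * U \<le> (1 - \<kappa> * r)\<^sup>2 * L" by linarith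
        then show ?thesis using 3 by simp
      qed
    qed
  qed
  then show ?thesis by (simp add: r_def)
qed

section \<open>Upper bound for three free vertices, lower bound for two\<close>

locale penalised_online_forest = online_forest +
  fixes U L \<kappa> :: "nat \<Rightarrow> real"
  assumes \<theta>_eq: "\<And>s. \<theta> s = 1 - \<kappa> s / real s"
    and \<kappa>: "\<And>s. 0 \<le> \<kappa> s" "\<And>s. \<kappa> s \<le> 1"
    and U_nonneg: "\<And>s. 0 \<le> U s"
    and U_start: "1 \<le> U N" and L_start: "L N \<le> 1"
    and U_\<kappa>: "\<And>s. N \<le> s \<Longrightarrow> \<kappa> (Suc s) * U s = surv 4 N s"
    and L_\<kappa>: "\<And>s. N \<le> s \<Longrightarrow> \<kappa> (Suc s) * L s \<le> U s"
    and U_Suc: "\<And>s. N \<le> s \<Longrightarrow>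
      U s - 3 / real (Suc s) * (1 - 1 / real (Suc s)) * surv 4 N s \<le> U (Suc s)"
    and L_Suc: "\<And>s. N \<le> s \<Longrightarrow> L (Suc s) \<le> L s - 2 / real (Suc s) * U s"
begin

lemma \<theta>_ge: "1 - 1 / real s \<le> \<theta> s"
  unfolding \<theta>_eq using \<kappa>(2)[of s] by (intro diff_left_mono divide_right_mono) auto

text \<open>A hit removes the weight of a list of four entries, at least \<open>surv 4 N s\<close>.
  The head may already belong to \<open>W\<close>; this does no harm because
  \<open>Fv_ge_surv\<close> counts list entries. For roots, the penalty makes up for the missing
  hit.\<close>

lemma Fv_le_U:
  assumes "N \<le> s" "card S = s" "S \<subseteq> E" and W: "distinct W" "length W = 3"
  shows "Fv W S \<le> U s"
  using assms(1-3)
proof (induction s arbitrary: S rule: nat_induct_at_least)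
  case base
  then show ?case using Fv_early[of S W] U_start by simp
next
  case (Suc s)
  let ?d = "card (hits S W)" and ?z = "length (roots S W)"
  have fin: "finite S" using finite_edges Suc.prems by blast
  have card: "card (S - {e}) = s" "S - {e} \<subseteq> E" if "e \<in> S" for e
    using that Suc.prems fin by (auto simp: card_Diff_singleton Suc.prems(1))
  have miss: "Fv W (S - {e}) \<le> U s" if "e \<in> S" for e
    using Suc.IH[of "S - {e}"] card[OF that] by simp
  have hit: "Fv W (S - {e}) - Fv (head (T S) e # W) (S - {e}) \<le> U s - surv 4 N s"
    if "e \<in> hits S W" for e
  proof -
    have e: "e \<in> S" using that hits_subset by blast
    have "surv (length (head (T S) e # W)) N s \<le> Fv (head (T S) e # W) (S - {e})"
      using card[OF e] Suc.hyps by (intro Fv_ge_surv \<theta>_ge) auto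
    then show ?thesis using miss[OF e] card[OF e] W(2) by simp
  qed
  have "Fv W S \<le> \<theta> (Suc s) ^ ?z * (U s - real ?d * (U s - (U s - surv 4 N s)) / Suc s)"
    using Suc.prems Suc.hyps hit miss by (intro Fv_step_le) auto
  also have "\<dots> = (1 - \<kappa> (Suc s) / Suc s) ^ ?z * (U s - real ?d * surv 4 N s / Suc s)"
    by (simp add: \<theta>_eq)
  also have "\<dots> \<le> U s - 3 / Suc s * (1 - 1 / Suc s) * surv 4 N s"
    using card_hits(2)[OF Suc.prems(2) W(1)] W(2) U_\<kappa>[OF Suc.hyps] \<kappa> surv_nonneg
    by (intro penalised_upper) auto
  also have "\<dots> \<le> U (Suc s)" by (rule U_Suc[OF Suc.hyps])
  finally show ?case .
qed

text \<open>Simplicity of the graph enters here: once \<open>{u, v}\<close> has been removed, no edge leaving one of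
  \<open>u\<close>, \<open>v\<close> points to the other.\<close>
lemma Fv_ge_L:
  assumes "N \<le> s" "card S = s" "S \<subseteq> E" "{u, v} \<notin> S" and uv: "u \<noteq> v"
  shows "L s \<le> Fv [u, v] S"
  using assms(1-4)
proof (induction s arbitrary: S rule: nat_induct_at_least)
  case base
  then show ?case using Fv_early[of S "[u, v]"] L_start by simp
next
  case (Suc s)
  let ?W = "[u, v]"
  let ?d = "card (hits S ?W)" and ?z = "length (roots S ?W)"
  have fin: "finite S" using finite_edges Suc.prems by blast
  have card: "card (S - {e}) = s" "S - {e} \<subseteq> E" if "e \<in> S" for e
    using that Suc.prems fin by (auto simp: card_Diff_singleton Suc.prems(1))
  have miss: "L s \<le> Fv ?W (S - {e})" if "e \<in> S" for e
    using Suc.IH[of "S - {e}"] card[OF that] Suc.prems by simp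
  have hit: "L s - U s \<le> Fv ?W (S - {e}) - Fv (head (T S) e # ?W) (S - {e})"
    if h: "e \<in> hits S ?W" for e
  proof -
    have e: "e \<in> S" "e \<in> T S" "tail (T S) e = u \<or> tail (T S) e = v"
      using h T_subset[of S] by (auto simp: hits_def)
    note ed = T_edge[OF Suc.prems(2) e(2)]
    have "head (T S) e \<noteq> u \<and> head (T S) e \<noteq> v"
      using e(1,3) ed Suc.prems(3) by (metis insert_commute)
    then have "Fv (head (T S) e # ?W) (S - {e}) \<le> U s"
      using card[OF e(1)] Suc.hyps uv by (intro Fv_le_U) auto
    then show ?thesis using miss[OF e(1)] card[OF e(1)] by simp
  qed
  have "L (Suc s) \<le> L s - 2 / Suc s * U s" by (rule L_Suc[OF Suc.hyps])
  also have "\<dots> \<le> (1 - \<kappa> (Suc s) / Suc s) ^ ?z * (L s - real ?d * U s / Suc s)"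
    using card_hits(2)[OF Suc.prems(2), of ?W] uv L_\<kappa>[OF Suc.hyps] \<kappa> U_nonneg
    by (intro penalised_lower) auto
  also have "\<dots> = \<theta> (Suc s) ^ ?z * (L s - real ?d * (L s - (L s - U s)) / Suc s)"
    by (simp add: \<theta>_eq)
  also have "\<dots> \<le> Fv ?W S"
    using Suc.prems Suc.hyps hit miss by (intro Fv_step_ge) auto
  finally show ?case .
qed

end

section \<open>From free pairs of vertices to the competitive ratio\<close>

context online_forest
begin

text \<open>The edge \<open>e\<close> is preceded by exactly \<open>j\<close> edges with probability
  \<open>1 / card S\<close>. By \<open>forest_mono\<close> it then belongs to the forest of the
  edges seen so far, and \<open>L j\<close> bounds its chance of acceptance from below.\<close>

lemma avg_wins_ge:
  assumes L: "\<And>s S u v. N \<le> s \<Longrightarrow> card S = s \<Longrightarrow> S \<subseteq> E \<Longrightarrow> {u, v} \<notin> S \<Longrightarrow> u \<noteq> v \<Longrightarrow> L s \<le> Fv [u, v] S"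
    and "S \<subseteq> E" "e \<in> T S"
  shows "(\<Sum>j\<in>{N..<card S}. L j) \<le> real (card S) * avg (wins e) S"
  using assms(2,3)
proof (induction "card S" arbitrary: S)
  case 0
  then have "card S = 0" by simp
  then show ?case by simp
next
  case (Suc s)
  have fin: "finite S" using finite_edges Suc.prems by blast
  have eS: "e \<in> S" using Suc.prems T_subset by blast
  obtain u v where uv: "u \<noteq> v" "e = {u, v}"
    using edge_doubleton[of e] eS Suc.prems(1) by (meson subsetD)
  have card: "card (S - {f}) = s" "S - {f} \<subseteq> E" if "f \<in> S" for f
    using that Suc.prems fin by (auto simp: card_Diff_singleton Suc.hyps(2)[symmetric])
  let ?X = "\<Sum>j\<in>{N..<s}. L j"
  have IH: "?X \<le> real s * avg (wins e) (S - {f})" if "f \<in> S - {e}" for f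
    using Suc.hyps(1)[of "S - {f}"] card[of f] that forest_mono[OF Suc.prems(2), of "S - {f}"] eS by auto
  have "card (S - {e}) = s" using card eS by blast
  then have "real s * ?X = (\<Sum>f\<in>S - {e}. ?X)" by simp
  also have "\<dots> \<le> (\<Sum>f\<in>S - {e}. real s * avg (wins e) (S - {f}))" by (intro sum_mono IH)
  also have "\<dots> = real s * (\<Sum>f\<in>S - {e}. avg (wins e) (S - {f}))" by (simp add: sum_distrib_left)
  finally have *: "real s * ?X \<le> real s * (\<Sum>f\<in>S - {e}. avg (wins e) (S - {f}))" .
  have X: "?X \<le> (\<Sum>f\<in>S - {e}. avg (wins e) (S - {f}))"
  \<comment> \<open>For \<open>s = 0\<close> the factor \<open>real s\<close> cannot be cancelled,
    but then both sums are empty.\<close>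
  proof (cases "s = 0")
    case True
    then have "S - {e} = {}" using card(1)[OF eS] fin by simp
    then show ?thesis unfolding \<open>S - {e} = {}\<close> using True by simp
  next
    case False
    then show ?thesis using * by simp
  qed
  have "(\<Sum>j\<in>{N..<Suc s}. L j) = ?X + (if N \<le> s then L s else 0)" by (simp add: sum.atLeastLessThan_Suc)
  also have "\<dots> \<le> (\<Sum>f\<in>S - {e}. avg (wins e) (S - {f})) + (if N \<le> s then Fv [u, v] (S - {e}) else 0)"
    using X L[of s "S - {e}" u v] card[OF eS] uv by auto
  also have "\<dots> \<le> Suc s * avg (wins e) S"
    using Suc.prems Suc.hyps(2) uv by (intro avg_wins_Suc) auto
  finally show ?case by (simp add: Suc.hyps(2)[symmetric])
qed

lemma competitive:
  assumes m: "m = card E" and w: "\<And>e. e \<in> E \<Longrightarrow> 0 \<le> w e" and "0 \<le> \<alpha>"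
    and L: "\<And>s S u v. N \<le> s \<Longrightarrow> card S = s \<Longrightarrow> S \<subseteq> E \<Longrightarrow> {u, v} \<notin> S \<Longrightarrow> u \<noteq> v \<Longrightarrow> L s \<le> Fv [u, v] S"
    and \<alpha>: "0 < m \<Longrightarrow> real m \<le> \<alpha> * (\<Sum>j\<in>{N..<m}. L j)"
  shows "OPT E w \<le> \<alpha> * expected_ALG A V E w"
proof -
  have fin: "finite E" by (simp add: finite_edges)
  have nn: "0 \<le> avg (wins e) E" for e
    using avg_mono[of E "\<lambda>_. 0" "wins e"] avg_const[of E 0] by (simp add: wins_def)
  have one: "1 \<le> \<alpha> * avg (wins e) E" if e: "e \<in> T E" for e
  proof -
    have "0 < m" using e T_subset fin m by (auto simp: card_gt_0_iff)
    have "real m \<le> \<alpha> * (\<Sum>j\<in>{N..<m}. L j)" by (rule \<alpha>[OF \<open>0 < m\<close>])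
    also have "\<dots> \<le> \<alpha> * (real m * avg (wins e) E)"
      using avg_wins_ge[OF L subset_refl e] \<open>0 \<le> \<alpha>\<close>
      by (intro mult_left_mono) (simp_all add: m[symmetric])
    finally have "real m * 1 \<le> real m * (\<alpha> * avg (wins e) E)" by (simp add: algebra_simps)
    then show ?thesis using \<open>0 < m\<close> by (simp only: mult_le_cancel_left_pos of_nat_0_less_iff)
  qed
  have ed: "\<exists>a b. a \<noteq> b \<and> e = {a, b}" if "e \<in> E" for e using edge_doubleton[OF that] .
  have "OPT E w \<le> sum w (T E)"
    by (rule OPT_le_forest[OF fin inj_on_rk_edges[OF subset_refl] ed w])
  also have "\<dots> \<le> (\<Sum>e\<in>T E. \<alpha> * (w e * avg (wins e) E))"
  proof (rule sum_mono)
    fix e assume e: "e \<in> T E"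
    then have "w e * 1 \<le> w e * (\<alpha> * avg (wins e) E)"
      using one w T_subset by (intro mult_left_mono) auto
    then show "w e \<le> \<alpha> * (w e * avg (wins e) E)" by (simp add: algebra_simps)
  qed
  also have "\<dots> \<le> (\<Sum>e\<in>E. \<alpha> * (w e * avg (wins e) E))"
    using fin T_subset w nn \<open>0 \<le> \<alpha>\<close> by (intro sum_mono2) auto
  also have "\<dots> = \<alpha> * expected_ALG A V E w" by (simp add: expected_ALG_eq[OF m] sum_distrib_left)
  finally show ?thesis .
qed

end

subsection \<open>Evaluation of the competitive ratio\<close>

lemma surv_Suc_gt:
  assumes "N \<le> s" "k \<le> N + 1"
  shows "surv k N (Suc s) = surv k N s * (1 - real k / real (Suc s))"
  using assms by (simp add: surv_Suc)

text \<open>The sum telescopes, since \<open>s * surv k N s\<close> decreases by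
  \<open>(k - 1) * surv k N s\<close> in one step.\<close>

lemma sum_surv:
  assumes "k \<le> N + 1" "N \<le> s"
  shows "(real k - 1) * (\<Sum>j\<in>{N..<s}. surv k N j) = real N - real s * surv k N s"
  using assms(2)
proof (induction s rule: nat_induct_at_least)
  case (Suc s)
  have "real (Suc s) * surv k N (Suc s) = (real (Suc s) - real k) * surv k N s"
    unfolding surv_Suc_gt[OF Suc.hyps assms(1)] by (simp add: field_simps)
  then show ?case using Suc by (simp add: algebra_simps)
qed simp

lemma surv_2_closed:
  assumes "1 \<le> N" "N \<le> s"
  shows "surv 2 N s * (real s * (real s - 1)) = real N * (real N - 1)"
  using assms(2)
proof (induction s rule: nat_induct_at_least)
  case (Suc s)
  have "surv 2 N (Suc s) * real (Suc s) = surv 2 N s * (real s - 1)"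
    using surv_Suc_gt[of N s 2] Suc.hyps assms(1) by (simp add: field_simps)
  then have "surv 2 N (Suc s) * real (Suc s) * real s = surv 2 N s * (real s - 1) * real s"
    by (simp only:)
  then have "surv 2 N (Suc s) * (real (Suc s) * real s) = surv 2 N s * (real s * (real s - 1))"
    by (simp only: ac_simps)
  then show ?case using Suc.IH by simp
qed simp

lemma surv_4_le:
  assumes "1 \<le> N" "N \<le> s"
  shows "surv 4 N s \<le> (real N / real s) ^ 4"
  using assms(2)
proof (induction s rule: nat_induct_at_least)
  case base
  then show ?case using assms by simp
next
  case (Suc s)
  have s: "0 < s" using assms Suc.hyps by simp
  have "1 - 4 / real (Suc s) \<le> (1 - 1 / real (Suc s)) ^ 4"
    using Bernoulli_inequality[of "- 1 / real (Suc s)" 4] by (simp add: field_simps)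
  also have "1 - 1 / real (Suc s) = real s / real (Suc s)" by (simp add: field_simps)
  finally have "max 0 (1 - 4 / real (Suc s)) \<le> (real s / real (Suc s)) ^ 4" by simp
  then have "surv 4 N (Suc s) \<le> (real N / real s) ^ 4 * (real s / real (Suc s)) ^ 4"
    using Suc surv_nonneg by (simp only: surv_Suc of_nat_numeral) (intro mult_mono; simp)
  also have "\<dots> = (real N / real (Suc s)) ^ 4"
    using s by (simp add: power_mult_distrib[symmetric])
  finally show ?case .
qed

text \<open>The factor \<open>N / (N + 1)\<close> absorbs the second-order event that, in the same step, one vertex is
  hit and another one is penalised as a root.\<close>
definition eta :: "nat \<Rightarrow> real" where
  "eta N = 3 / 4 * (real N / (real N + 1))"

text \<open>The discrete form of 1/4 + 3/4 r^4. \<open>surv 4\<close> loses the fraction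
  \<open>4 / (s + 1)\<close> of itself in a step, so this affine function of it falls at about the
  rate \<open>3 / s * surv 4 N s\<close> required for P_3.\<close>

definition upper :: "nat \<Rightarrow> nat \<Rightarrow> real" where
  "upper N s = 1 - eta N * (1 - surv 4 N s)"

definition lower :: "nat \<Rightarrow> nat \<Rightarrow> real" where
  "lower N s = 1 - 2 * (\<Sum>j\<in>{N<..s}. upper N (j - 1) / real j)"

text \<open>The least penalty for which a root makes \<open>upper\<close> decrease as fast as a hit does.\<close>
definition penalty :: "nat \<Rightarrow> nat \<Rightarrow> real" where
  "penalty N s = surv 4 N (s - 1) / upper N (s - 1)"

lemma eta_bounds: "0 \<le> eta N" "eta N \<le> 3 / 4"
  by (auto simp: eta_def field_simps)

lemma eta_mult: "eta N * (real N + 1) = 3 / 4 * real N"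
proof -
  have "real N + 1 \<noteq> 0" by linarith
  then have "real N / (real N + 1) * (real N + 1) = real N" by simp
  then show ?thesis by (simp only: eta_def mult.assoc)
qed

lemma upper_ge: "(1 + 3 * surv 4 N s) / 4 \<le> upper N s"
proof -
  have "eta N * (1 - surv 4 N s) \<le> 3 / 4 * (1 - surv 4 N s)"
    using eta_bounds surv_le_1 by (intro mult_right_mono) auto
  then show ?thesis by (simp add: upper_def field_simps)
qed

lemma upper_ge_surv: "surv 4 N s \<le> upper N s"
  using upper_ge[of N s] surv_le_1[of 4 N s] by (simp add: field_simps)

lemma upper_pos: "0 < upper N s"
  using upper_ge[of N s] surv_nonneg[of 4 N s] by (simp add: field_simps)

lemma penalty_bounds: "0 \<le> penalty N s" "penalty N s \<le> 1"
  using upper_pos[of N "s - 1"] upper_ge_surv[of N "s - 1"] surv_nonneg[of 4 N "s - 1"]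
  by (auto simp: penalty_def field_simps)

lemma lower_Suc: "N \<le> s \<Longrightarrow> lower N (Suc s) = lower N s - 2 / real (Suc s) * upper N s"
proof -
  assume "N \<le> s"
  then have "{N<..Suc s} = insert (Suc s) {N<..s}" by auto
  then show ?thesis by (simp add: lower_def algebra_simps)
qed

text \<open>A rough bound that serves \<open>surv_lower_le\<close>: with \<open>surv 4\<close> in
  place of \<open>upper\<close>, the recursion of \<open>lower\<close> is solved exactly by the
  right side.\<close>

lemma lower_le:
  assumes "3 \<le> N" "N \<le> s" shows "lower N s \<le> (1 + surv 4 N s) / 2"
  using assms(2)
proof (induction s rule: nat_induct_at_least)
  case base
  then show ?case by (simp add: lower_def)
next
  case (Suc s)
  have "2 / real (Suc s) * surv 4 N s \<le> 2 / real (Suc s) * upper N s"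
    using upper_ge_surv by (intro mult_left_mono) auto
  moreover have "(1 + surv 4 N (Suc s)) / 2 = (1 + surv 4 N s) / 2 - 2 / real (Suc s) * surv 4 N s"
    using surv_Suc_gt[of N s 4] Suc.hyps assms(1) by (simp add: field_simps)
  ultimately show ?case using Suc.IH lower_Suc[OF Suc.hyps] by linarith
qed

text \<open>Divided by \<open>upper\<close>, this says that the penalty tuned to three vertices is
  not too large for two, as \<open>penalised_lower\<close> requires.\<close>

lemma surv_lower_le:
  assumes "3 \<le> N" "N \<le> s" shows "surv 4 N s * lower N s \<le> (upper N s)\<^sup>2"
proof -
  let ?a = "surv 4 N s"
  have "?a * lower N s \<le> ?a * ((1 + ?a) / 2)"
    using lower_le[OF assms] surv_nonneg by (intro mult_left_mono)
  also have "\<dots> = ((1 + 3 * ?a) / 4)\<^sup>2 - ((1 - ?a) / 4)\<^sup>2"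
    by (simp add: power2_eq_square field_simps)
  also have "\<dots> \<le> ((1 + 3 * ?a) / 4)\<^sup>2" by simp
  also have "\<dots> \<le> (upper N s)\<^sup>2"
    using upper_ge surv_nonneg[of 4 N s] by (intro power_mono) auto
  finally show ?thesis .
qed

lemma upper_Suc:
  assumes "3 \<le> N" "N \<le> s"
  shows "upper N s - 3 / real (Suc s) * (1 - 1 / real (Suc s)) * surv 4 N s \<le> upper N (Suc s)"
proof -
  let ?n = "real (Suc s)"
  \<comment> \<open>Among all steps \<open>s \<ge> N\<close> the factor
    \<open>1 - 1 / (s + 1)\<close> is smallest at \<open>s = N\<close>, which is the value built
    into \<open>eta\<close>.\<close>
  have "real N / (real N + 1) = 1 - 1 / (real N + 1)" by (simp add: field_simps)
  also have "\<dots> \<le> 1 - 1 / ?n"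
    using assms by (intro diff_left_mono divide_left_mono) auto
  finally have "3 * (real N / (real N + 1)) \<le> 3 * (1 - 1 / ?n)" by (rule mult_left_mono) simp
  moreover have "4 * (3 / 4 :: real) = 3" by simp
  then have "4 * eta N = 3 * (real N / (real N + 1))"
    by (simp only: eta_def mult.assoc[symmetric])
  ultimately have "4 * eta N \<le> 3 * (1 - 1 / ?n)" by (simp only:)
  then have "4 * eta N * (surv 4 N s / ?n) \<le> 3 * (1 - 1 / ?n) * (surv 4 N s / ?n)"
    using surv_nonneg by (intro mult_right_mono) auto
  moreover have sq: "surv 4 N (Suc s) = surv 4 N s - 4 * (surv 4 N s / ?n)"
    using surv_Suc_gt[of N s 4] assms by (simp add: algebra_simps)
  have "upper N (Suc s) = upper N s - 4 * eta N * (surv 4 N s / ?n)"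
    unfolding upper_def sq by (simp add: algebra_simps)
  moreover have "3 / ?n * (1 - 1 / ?n) * surv 4 N s = 3 * (1 - 1 / ?n) * (surv 4 N s / ?n)" by simp
  ultimately show ?thesis by linarith
qed

section \<open>Sum of the lower bound over the selection phase\<close>

definition hsum :: "nat \<Rightarrow> nat \<Rightarrow> real" where
  "hsum N s = (\<Sum>j\<in>{N<..s}. 1 / real j)"

lemma hsum_Suc: "N \<le> s \<Longrightarrow> hsum N (Suc s) = hsum N s + 1 / real (Suc s)"
proof -
  assume "N \<le> s"
  then have "{N<..Suc s} = insert (Suc s) {N<..s}" by auto
  then show ?thesis by (simp add: hsum_def)
qed

lemma sum_hsum: "N \<le> s \<Longrightarrow> (\<Sum>j\<in>{N..<s}. hsum N j) = real s * hsum N s - (real s - real N)"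
proof (induction s rule: nat_induct_at_least)
  case base
  then show ?case by (simp add: hsum_def)
next
  case (Suc s)
  have "real (Suc s) * hsum N (Suc s) = real (Suc s) * hsum N s + 1"
    using Suc.hyps by (simp add: hsum_Suc field_simps)
  moreover have "(\<Sum>j\<in>{N..<Suc s}. hsum N j) = (\<Sum>j\<in>{N..<s}. hsum N j) + hsum N s"
    using Suc.hyps by simp
  ultimately show ?case using Suc.IH by (simp add: algebra_simps)
qed

lemma lower_closed:
  assumes "3 \<le> N" "N \<le> s"
  shows "lower N s = 1 - 2 * (1 - eta N) * hsum N s - eta N / 2 * (1 - surv 4 N s)"
  using assms(2)
proof (induction s rule: nat_induct_at_least)
  case base
  then show ?case by (simp add: lower_def hsum_def)
next
  case (Suc s)
  have "surv 4 N (Suc s) = surv 4 N s - 4 * (surv 4 N s / real (Suc s))"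
    using surv_Suc_gt[of N s 4] Suc.hyps assms(1) by (simp add: algebra_simps)
  moreover have "2 / real (Suc s) * upper N s =
      2 * (1 - eta N) * (1 / real (Suc s)) + 2 * eta N * (surv 4 N s / real (Suc s))"
    by (simp add: upper_def divide_inverse algebra_simps)
  moreover have "2 * (1 - eta N) * (hsum N s + 1 / real (Suc s)) =
      2 * (1 - eta N) * hsum N s + 2 * (1 - eta N) * (1 / real (Suc s))"
    by (rule distrib_left)
  moreover have "eta N / 2 * (1 - (surv 4 N s - 4 * (surv 4 N s / real (Suc s)))) =
      eta N / 2 * (1 - surv 4 N s) + 2 * eta N * (surv 4 N s / real (Suc s))"
    by (simp add: algebra_simps)
  ultimately show ?case
    unfolding lower_Suc[OF Suc.hyps] hsum_Suc[OF Suc.hyps] Suc.IH by (simp only:)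
qed

lemma sum_lower:
  assumes "3 \<le> N" "N \<le> s"
  shows "(\<Sum>j\<in>{N..<s}. lower N j) = (real s - real N) * (1 - eta N / 2)
    - 2 * (1 - eta N) * (real s * hsum N s - (real s - real N))
    + eta N / 6 * (real N - real s * surv 4 N s)"
proof -
  have "(\<Sum>j\<in>{N..<s}. lower N j) =
      (\<Sum>j\<in>{N..<s}. (1 - eta N / 2) - 2 * (1 - eta N) * hsum N j + eta N / 2 * surv 4 N j)"
    using assms(1) by (intro sum.cong) (auto simp: lower_closed algebra_simps)
  also have "\<dots> = (real s - real N) * (1 - eta N / 2) - 2 * (1 - eta N) * (\<Sum>j\<in>{N..<s}. hsum N j)
      + eta N / 2 * (\<Sum>j\<in>{N..<s}. surv 4 N j)"
    using assms(2)
    by (simp only: sum.distrib sum_subtractf sum_distrib_left[symmetric] sum_constant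
        card_atLeastLessThan of_nat_diff right_diff_distrib)
  also have "(\<Sum>j\<in>{N..<s}. surv 4 N j) = (real N - real s * surv 4 N s) / 3"
    using sum_surv[of 4 N s] assms by simp
  finally show ?thesis by (simp add: sum_hsum[OF assms(2)])
qed

text \<open>The midpoint estimate of the integral of the convex function 1/x over the interval of
  length 1 around \<open>n\<close>. Its logarithms telescope in \<open>hsum_le_ln\<close>.\<close>

lemma inverse_le_ln:
  assumes "1 \<le> (n :: real)"
  shows "1 / n \<le> ln ((2 * n + 1) / (2 * n - 1))"
  using ln_inverse_approx_ge[of "2 * n - 1" "2 * n + 1"] assms by (simp add: ln_div field_simps)

lemma hsum_le_ln:
  assumes "N \<le> s" shows "hsum N s \<le> ln ((2 * real s + 1) / (2 * real N + 1))"
  using assms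
proof (induction s rule: nat_induct_at_least)
  case base
  then show ?case by (simp add: hsum_def)
next
  case (Suc s)
  have "(2 * real (Suc s) + 1) / (2 * real N + 1) =
      (2 * real s + 1) / (2 * real N + 1) * ((2 * real (Suc s) + 1) / (2 * real (Suc s) - 1))"
  proof -
    have s: "2 * real (Suc s) - 1 = 2 * real s + 1" "2 * real s + 1 \<noteq> 0" by simp_all
    have cancel: "b / c = a / c * (b / a)" if "a \<noteq> 0" for a b c :: real using that by simp
    show ?thesis unfolding s(1) by (rule cancel[OF s(2)])
  qed
  then have "ln ((2 * real (Suc s) + 1) / (2 * real N + 1)) =
      ln ((2 * real s + 1) / (2 * real N + 1)) + ln ((2 * real (Suc s) + 1) / (2 * real (Suc s) - 1))"
    by (simp only:) (rule ln_mult_pos; intro divide_pos_pos; simp add: add_pos_nonneg)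
  then show ?case
    using Suc inverse_le_ln[of "real (Suc s)"] by (simp add: hsum_Suc)
qed

text \<open>To leading order the sum is \<open>311 / 576 * N\<close>, which gives the ratio 1152 /
  311 < 3.705; the room up to 3.77 pays for the lower-order terms.\<close>

lemma sum_lower_ge_even:
  assumes "8 \<le> N"
  shows "real (2 * N) \<le> 3.77 * (\<Sum>j\<in>{N..<2 * N}. lower N j)"
proof -
  let ?x = "real N" and ?h = "hsum N (2 * N)" and ?a = "surv 4 N (2 * N)"
  define T where "T = (\<Sum>j\<in>{N..<2 * N}. lower N j)"
  have x: "8 \<le> ?x" using assms by simp
  have "(2 * real (2 * N) + 1) / (2 * ?x + 1) = 2 * (1 + (- 1 / (4 * ?x + 2)))"
    using x by (simp add: divide_simps) (simp add: algebra_simps)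
  then have "?h \<le> ln (2 * (1 + (- 1 / (4 * ?x + 2))))"
    using hsum_le_ln[of N "2 * N"] by simp
  also have "\<dots> = ln 2 + ln (1 + (- 1 / (4 * ?x + 2)))" using x by (subst ln_mult) (auto simp: field_simps)
  also have "\<dots> \<le> 25 / 36 + (- 1 / (4 * ?x + 2))"
    using ln2_le_25_over_36 x by (intro add_mono ln_add_one_self_le_self2) (auto simp: field_simps)
  finally have "2 * ?x * ?h \<le> 2 * ?x * (25 / 36 + (- 1 / (4 * ?x + 2)))"
    using x by (intro mult_left_mono) auto
  \<comment> \<open>The constant 4/9 bounds \<open>?x / (2 * ?x + 1)\<close> from below once
    \<open>?x \<ge> 4\<close>.\<close>
  also have "\<dots> \<le> 25 / 18 * ?x - 4 / 9" using x by (simp add: field_simps)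
  finally have h: "2 * ?x * ?h \<le> 25 / 18 * ?x - 4 / 9" .
  have "?a \<le> (1 / 2) ^ 4" using surv_4_le[of N "2 * N"] assms by simp
  then have "2 * ?x * ?a \<le> 2 * ?x * (1 / 2) ^ 4" using x by (intro mult_left_mono) auto
  then have a: "2 * ?x * ?a \<le> ?x / 8" by (simp add: power4_eq_xxxx)
  have "T = ?x * (1 - eta N / 2) - 2 * (1 - eta N) * (2 * ?x * ?h - ?x) + eta N / 6 * (?x - 2 * ?x * ?a)"
    unfolding T_def using sum_lower[of N "2 * N"] assms by simp
  moreover have "2 * (1 - eta N) * (2 * ?x * ?h - ?x) \<le> 2 * (1 - eta N) * (25 / 18 * ?x - 4 / 9 - ?x)"
    using h eta_bounds[of N] by (intro mult_left_mono) auto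
  moreover have "eta N / 6 * (?x - ?x / 8) \<le> eta N / 6 * (?x - 2 * ?x * ?a)"
    using a eta_bounds[of N] by (intro mult_left_mono) auto
  ultimately have "?x * (1 - eta N / 2) - 2 * (1 - eta N) * (25 / 18 * ?x - 4 / 9 - ?x) +
      eta N / 6 * (?x - ?x / 8) \<le> T"
    by linarith
  moreover have "25 / 18 * ?x - 4 / 9 - ?x = 7 / 18 * ?x - 4 / 9" "?x - ?x / 8 = 7 / 8 * ?x"
    by simp_all
  ultimately have "?x * (1 - eta N / 2) - 2 * (1 - eta N) * (7 / 18 * ?x - 4 / 9) +
      eta N / 6 * (7 / 8 * ?x) \<le> T"
    by (simp only:)
  \<comment> \<open>Multiplying by \<open>?x + 1\<close> clears the denominator of
    \<open>eta N\<close>, see \<open>eta_mult\<close>.\<close>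
  then have h1: "(?x * (1 - eta N / 2) - 2 * (1 - eta N) * (7 / 18 * ?x - 4 / 9) + eta N / 6 * (7 / 8 * ?x)) * (?x + 1)
      \<le> T * (?x + 1)"
    using x by (intro mult_right_mono) auto
  have h2: "(?x * (1 - eta N / 2) - 2 * (1 - eta N) * (7 / 18 * ?x - 4 / 9) + eta N / 6 * (7 / 8 * ?x)) * (?x + 1) =
      ?x * (?x + 1) - 2 * (?x + 1) * (7 / 18 * ?x - 4 / 9)
      + (eta N * (?x + 1)) * (- ?x / 2 + 2 * (7 / 18 * ?x - 4 / 9) + 7 / 48 * ?x)"
    by (simp add: field_simps)
  have h3: "?x * (?x + 1) - 2 * (?x + 1) * (7 / 18 * ?x - 4 / 9)
      + (3 / 4 * ?x) * (- ?x / 2 + 2 * (7 / 18 * ?x - 4 / 9) + 7 / 48 * ?x) =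
      311 / 576 * ?x\<^sup>2 + 4 / 9 * ?x + 8 / 9"
    by (simp add: field_simps power2_eq_square)
  have h4: "2 * ?x * (?x + 1) = 2 * ?x\<^sup>2 + 2 * ?x"
    by (simp add: algebra_simps power2_eq_square)
  \<comment> \<open>The tangent of the square at 5 bounds the quadratic term from below by a linear
    one, so that linear arithmetic suffices for \<open>h5\<close>.\<close>
  have "0 \<le> ?x\<^sup>2 - 10 * ?x + 25"
    using zero_le_power2[of "?x - 5"] by (simp add: power2_eq_square algebra_simps)
  then have h5: "2 * ?x\<^sup>2 + 2 * ?x \<le> 3.77 * (311 / 576 * ?x\<^sup>2 + 4 / 9 * ?x + 8 / 9)"
    using x by simp
  have "311 / 576 * ?x\<^sup>2 + 4 / 9 * ?x + 8 / 9 \<le> T * (?x + 1)"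
    using h1 unfolding h2 eta_mult h3 .
  then have "3.77 * (311 / 576 * ?x\<^sup>2 + 4 / 9 * ?x + 8 / 9) \<le> 3.77 * (T * (?x + 1))"
    by (rule mult_left_mono) simp
  with h5 have "2 * ?x * (?x + 1) \<le> 3.77 * (T * (?x + 1))"
    unfolding h4 by (rule order_trans)
  then have "(2 * ?x) * (?x + 1) \<le> (3.77 * T) * (?x + 1)" by simp
  then show ?thesis using x unfolding T_def[symmetric] by (simp add: mult_le_cancel_right)
qed

lemma sum_lower_ge_odd:
  assumes "8 \<le> N"
  shows "real (2 * N + 1) \<le> 3.77 * (\<Sum>j\<in>{N..<2 * N + 1}. lower N j)"
proof -
  let ?x = "real N" and ?h = "hsum N (2 * N + 1)" and ?a = "surv 4 N (2 * N + 1)"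
  define T where "T = (\<Sum>j\<in>{N..<2 * N + 1}. lower N j)"
  have x: "8 \<le> ?x" using assms by simp
  have "(2 * real (2 * N + 1) + 1) / (2 * ?x + 1) = 2 * (1 + 1 / (4 * ?x + 2))"
    using x by (simp add: divide_simps) (simp add: algebra_simps)
  then have "?h \<le> ln (2 * (1 + 1 / (4 * ?x + 2)))"
    using hsum_le_ln[of N "2 * N + 1"] by simp
  also have "\<dots> = ln 2 + ln (1 + 1 / (4 * ?x + 2))" using x by (subst ln_mult) (auto simp: field_simps add_pos_pos)
  also have "\<dots> \<le> 25 / 36 + 1 / (4 * ?x + 2)"
    using ln2_le_25_over_36 x by (intro add_mono ln_add_one_self_le_self2) (auto simp: field_simps)
  finally have "(2 * ?x + 1) * ?h \<le> (2 * ?x + 1) * (25 / 36 + 1 / (4 * ?x + 2))"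
    using x by (intro mult_left_mono) auto
  also have "\<dots> = 25 / 36 * (2 * ?x + 1) + 1 / 2" using x by (simp add: field_simps)
  finally have h: "(2 * ?x + 1) * ?h \<le> 25 / 36 * (2 * ?x + 1) + 1 / 2" .
  have "?a \<le> (?x / (2 * ?x + 1)) ^ 4" using surv_4_le[of N "2 * N + 1"] assms by (simp add: add.commute)
  also have "\<dots> \<le> (1 / 2) ^ 4" using x by (intro power_mono) (auto simp: field_simps)
  finally have "(2 * ?x + 1) * ?a \<le> (2 * ?x + 1) * (1 / 2) ^ 4" using x by (intro mult_left_mono) auto
  then have a: "(2 * ?x + 1) * ?a \<le> (2 * ?x + 1) / 16" by (simp add: power4_eq_xxxx)
  have "T = (?x + 1) * (1 - eta N / 2) - 2 * (1 - eta N) * ((2 * ?x + 1) * ?h - (?x + 1)) +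
      eta N / 6 * (?x - (2 * ?x + 1) * ?a)"
    unfolding T_def using sum_lower[of N "2 * N + 1"] assms by (simp add: algebra_simps)
  moreover have "2 * (1 - eta N) * ((2 * ?x + 1) * ?h - (?x + 1)) \<le>
      2 * (1 - eta N) * (25 / 36 * (2 * ?x + 1) + 1 / 2 - (?x + 1))"
    using h eta_bounds[of N] by (intro mult_left_mono) auto
  moreover have "eta N / 6 * (?x - (2 * ?x + 1) / 16) \<le> eta N / 6 * (?x - (2 * ?x + 1) * ?a)"
    using a eta_bounds[of N] by (intro mult_left_mono) auto
  ultimately have "(?x + 1) * (1 - eta N / 2) - 2 * (1 - eta N) * (25 / 36 * (2 * ?x + 1) + 1 / 2 - (?x + 1)) +
      eta N / 6 * (?x - (2 * ?x + 1) / 16) \<le> T"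
    by linarith
  moreover have "25 / 36 * (2 * ?x + 1) + 1 / 2 - (?x + 1) = 7 / 18 * ?x + 7 / 36"
    "?x - (2 * ?x + 1) / 16 = 7 / 8 * ?x - 1 / 16" by (simp_all add: field_simps)
  ultimately have "(?x + 1) * (1 - eta N / 2) - 2 * (1 - eta N) * (7 / 18 * ?x + 7 / 36) +
      eta N / 6 * (7 / 8 * ?x - 1 / 16) \<le> T"
    by (simp only:)
  then have h1: "((?x + 1) * (1 - eta N / 2) - 2 * (1 - eta N) * (7 / 18 * ?x + 7 / 36) +
      eta N / 6 * (7 / 8 * ?x - 1 / 16)) * (?x + 1) \<le> T * (?x + 1)"
    using x by (intro mult_right_mono) auto
  have h2: "((?x + 1) * (1 - eta N / 2) - 2 * (1 - eta N) * (7 / 18 * ?x + 7 / 36) +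
      eta N / 6 * (7 / 8 * ?x - 1 / 16)) * (?x + 1) =
      (?x + 1) * (?x + 1) - 2 * (?x + 1) * (7 / 18 * ?x + 7 / 36)
      + (eta N * (?x + 1)) * (- (?x + 1) / 2 + 2 * (7 / 18 * ?x + 7 / 36) + (7 / 8 * ?x - 1 / 16) / 6)"
    by (simp add: field_simps)
  have h3: "(?x + 1) * (?x + 1) - 2 * (?x + 1) * (7 / 18 * ?x + 7 / 36)
      + (3 / 4 * ?x) * (- (?x + 1) / 2 + 2 * (7 / 18 * ?x + 7 / 36) + (7 / 8 * ?x - 1 / 16) / 6) =
      311 / 576 * ?x\<^sup>2 + 95 / 128 * ?x + 11 / 18"
    by (simp add: field_simps power2_eq_square)
  have h4: "(2 * ?x + 1) * (?x + 1) = 2 * ?x\<^sup>2 + 3 * ?x + 1"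
    by (simp add: algebra_simps power2_eq_square)
  have "0 \<le> ?x\<^sup>2 - 6 * ?x + 9"
    using zero_le_power2[of "?x - 3"] by (simp add: power2_eq_square algebra_simps)
  then have h5: "2 * ?x\<^sup>2 + 3 * ?x + 1 \<le> 3.77 * (311 / 576 * ?x\<^sup>2 + 95 / 128 * ?x + 11 / 18)"
    using x by simp
  have "311 / 576 * ?x\<^sup>2 + 95 / 128 * ?x + 11 / 18 \<le> T * (?x + 1)"
    using h1 unfolding h2 eta_mult h3 .
  then have "3.77 * (311 / 576 * ?x\<^sup>2 + 95 / 128 * ?x + 11 / 18) \<le> 3.77 * (T * (?x + 1))"
    by (rule mult_left_mono) simp
  with h5 have "(2 * ?x + 1) * (?x + 1) \<le> 3.77 * (T * (?x + 1))"
    unfolding h4 by (rule order_trans)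
  then have "(2 * ?x + 1) * (?x + 1) \<le> (3.77 * T) * (?x + 1)" by simp
  then show ?thesis using x unfolding T_def[symmetric] by (simp add: mult_le_cancel_right)
qed

lemma sum_lower_half_ge:
  assumes "16 < m"
  shows "real m \<le> 3.77 * (\<Sum>j\<in>{m div 2..<m}. lower (m div 2) j)"
proof (cases "even m")
  case True
  then have "m = 2 * (m div 2)" "8 \<le> m div 2" using assms by auto
  then show ?thesis using sum_lower_ge_even by metis
next
  case False
  then have "m = 2 * (m div 2) + 1" "8 \<le> m div 2" using assms by (auto elim!: oddE)
  then show ?thesis using sum_lower_ge_odd by metis
qed

text \<open>For few edges the simple bound \<open>surv 2\<close> is enough: the ratio is
  \<open>4 - 2 / N\<close> for \<open>m = 2 * N\<close> and \<open>4 - 2 / (N + 1)\<close> for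
  \<open>m = 2 * N + 1\<close>. This is below 3.77 up to \<open>m = 16\<close>, and no longer for
  \<open>m = 17\<close>.\<close>

lemma sum_surv_2_half_ge:
  assumes "0 < m" "m \<le> 16"
  shows "real m \<le> 3.77 * (\<Sum>j\<in>{m div 2..<m}. surv 2 (m div 2) j)"
proof (cases "m = 1")
  case False
  define N where "N = m div 2"
  have N: "1 \<le> N" "N \<le> m" "2 \<le> m" using assms False by (auto simp: N_def)
  have s: "(\<Sum>j\<in>{N..<m}. surv 2 N j) = real N - real m * surv 2 N m"
    using sum_surv[of 2 N m] N by simp
  have c: "(real m * surv 2 N m) * (real m - 1) = real N * (real N - 1)"
    using surv_2_closed[OF N(1,2)] by (simp add: algebra_simps)
  have "real m * (real m - 1) \<le> 3.77 * (real N * (real m - 1) - real N * (real N - 1))"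
  proof (cases "even m")
    case True
    then have m: "real m = 2 * real N" and "N \<le> 8" using assms by (auto simp: N_def)
    then have "0 \<le> real N * (8 - real N)" by simp
    then show ?thesis using N unfolding m by (simp add: algebra_simps)
  next
    case False
    then have m: "real m = 2 * real N + 1" and "N \<le> 7" using assms by (auto simp: N_def elim!: oddE)
    then have "0 \<le> real N * (7 - real N)" by simp
    then show ?thesis using N unfolding m by (simp add: algebra_simps)
  qed
  also have "\<dots> = 3.77 * (real N - real m * surv 2 N m) * (real m - 1)"
    unfolding c[symmetric] left_diff_distrib[symmetric] by (rule mult.assoc[symmetric])
  finally have "real m \<le> 3.77 * (real N - real m * surv 2 N m)"
    using N by (simp add: mult_le_cancel_right)
  then show ?thesis unfolding N_def[symmetric] s .
qed simp

theorem theorem1: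
  shows "\<exists>A :: 'v algorithm. \<forall>(V :: 'v set) (E :: 'v set set) (w :: 'v set \<Rightarrow> real).
           simple_graph V E \<and> (\<forall>e\<in>E. w e \<ge> 0) \<longrightarrow>
           3.77 * expected_ALG A V E w \<ge> OPT E w"
proof (intro exI allI impI)
  \<comment> \<open>One algorithm for all graphs: the sample size and the penalties depend on the
    number of edges only.\<close>
  define A :: "'v algorithm" where
    "A = (\<lambda>V m. alg (m div 2) (\<lambda>s. 1 - penalty (m div 2) s / real s) V)"
  fix V :: "'v set" and E :: "'v set set" and w :: "'v set \<Rightarrow> real"
  assume *: "simple_graph V E \<and> (\<forall>e\<in>E. 0 \<le> w e)"
  define m where "m = card E"
  define N where "N = m div 2"
  define \<theta> where "\<theta> s = 1 - penalty N s / real s" for s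
  have \<theta>1: "1 - 1 / real s \<le> \<theta> s" for s
    unfolding \<theta>_def using penalty_bounds by (intro diff_left_mono divide_right_mono) auto
  have \<theta>0: "0 \<le> \<theta> s" for s
    using \<theta>1[of s] by (cases "s = 0") (auto simp: \<theta>_def field_simps)
  have \<theta>2: "\<theta> s \<le> 1" for s
    using penalty_bounds by (simp add: \<theta>_def)
  have A: "A V m = alg N \<theta> V"
    by (simp add: A_def N_def \<theta>_def[abs_def])
  interpret online_forest V E w m N \<theta> A
    using * A \<theta>0 \<theta>2 by unfold_locales auto
  show "OPT E w \<le> 3.77 * expected_ALG A V E w"
  proof (cases "m \<le> 16")
    case True
    \<comment> \<open>The penalties are in force here too, but \<open>Fv_ge_surv\<close> allows for
      any \<open>\<theta>\<close> that is at least \<open>1 - 1 / s\<close>.\<close>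
    have "surv 2 N s \<le> Fv [u, v] S" if "N \<le> s" "card S = s" "S \<subseteq> E" for s S u v
      using Fv_ge_surv[OF \<theta>1 that, of "[u, v]"] by (simp add: numeral_2_eq_2)
    then show ?thesis
      using * sum_surv_2_half_ge[OF _ True] by (intro competitive[where L = "surv 2 N"]) (auto simp: m_def N_def)
  next
    case False
    then have N3: "3 \<le> N" by (auto simp: N_def)
    interpret penalised_online_forest V E w m N \<theta> A "upper N" "lower N" "penalty N"
    proof unfold_locales
      show "penalty N (Suc s) * lower N s \<le> upper N s" if "N \<le> s" for s
        using surv_lower_le[OF N3 that] upper_pos[of N s]
        by (simp add: penalty_def power2_eq_square field_simps)
      show "penalty N (Suc s) * upper N s = surv 4 N s" for s
        using upper_pos[of N s] by (simp add: penalty_def)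
    qed (use penalty_bounds upper_pos upper_Suc[OF N3] lower_Suc in
        \<open>auto simp: \<theta>_def upper_def lower_def less_imp_le\<close>)
    show ?thesis
      using * sum_lower_half_ge[of m] False Fv_ge_L
      by (intro competitive[where L = "lower N"]) (auto simp: m_def N_def)
  qed
qed

end
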